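(* For every integer $n\geq 1$ the following hold: (1) $\mathsf{H}_n\leq_B \mathsf{C}_{n+2}$; (2) $\mathsf{R}_n\leq_B \mathsf{C}_{n+2}$; (3) $\mathsf{R}_n\leq_B \mathsf{R}_{n+1}$.
   Context: For a Polish space $X$, $\mathcal{F}(X)$ is the Effros Borel space: the set of all non-empty closed subsets of $X$ with the $\sigma$-algebra generated by the sets $\{F\in\mathcal{F}(X): F\cap U\neq\emptyset\}$, $U\subseteq X$ open; it is a standard Borel space. $\mathcal{C}(X)\subseteq\mathcal{F}(X)$ is the subspace of all (non-empty) connected compact subsets of $X$; it is also a standard Borel space. For $n\geq 1$: - $\mathsf{C}_n$ is the equivalence relation on $\mathcal{C}([0,1]^n)$ defined by: $A\,\mathsf{C}_n\,B$ iff $A$ and $B$ (with subspace topologies) are homeomorphic. - $\mathsf{H}_n$ is the equivalence relation on $\mathcal{F}([0,1]^n)$ defined by: $A\,\mathsf{H}_n\,B$ iff $A$ and $B$ (with subspace topologies) are homeomorphic. - $\mathsf{R}_n$ is the equivalence relation on $\mathcal{F}([0,1]^n)$ defined by: $A\,\mathsf{R}_n\,B$ iff there is a homeomorphism $f:[0,1]^n\to[0,1]^n$ with $f[A]=B$. For equivalence relations $E$, $F$ on standard Borel spaces $X$, $Y$, $E\leq_B F$ ($E$ is Borel reducible to $F$) means that there is a Borel function $\varphi:X\to Y$ such that for all $x,y\in X$, $xEy\iff\varphi(x)F\varphi(y)$. *)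

theory Defs
  imports "HOL-Analysis.Analysis"
begin

definition effros :: "'a topology \<Rightarrow> 'a set measure" where
  "effros X = sigma {F. closedin X F \<and> F \<noteq> {}}
     ((\<lambda>U. {F. closedin X F \<and> F \<noteq> {} \<and> F \<inter> U \<noteq> {}}) ` {U. openin X U})"

definition continua :: "'a topology \<Rightarrow> 'a set measure" where
  "continua X = restrict_space (effros X) {F. compactin X F \<and> connectedin X F}"

lemma space_effros: "space (effros X) = {F. closedin X F \<and> F \<noteq> {}}"
  by (auto simp: effros_def space_measure_of_conv)

lemma sets_effros:
  "sets (effros X) = sigma_sets {F. closedin X F \<and> F \<noteq> {}}
     ((\<lambda>U. {F. closedin X F \<and> F \<noteq> {} \<and> F \<inter> U \<noteq> {}}) ` {U. openin X U})"
  unfolding effros_def by (rule sets_measure_of) auto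

text \<open>In a Hausdorff space compact sets are closed, so these are all the nonempty connected
  compact subsets.\<close>

lemma space_continua:
  assumes "Hausdorff_space X"
  shows "space (continua X) = {F. compactin X F \<and> connectedin X F \<and> F \<noteq> {}}"
  using compactin_imp_closedin[OF assms]
  by (auto simp: continua_def space_restrict_space space_effros)

text \<open>The library's \<open>Euclidean_space n\<close> is the space of all \<open>x :: nat \<Rightarrow> real\<close> with \<open>x i = 0\<close> for
  \<open>i \<ge> n\<close>, with the topology of \<open>\<real>\<^sup>n\<close>; hence the unit cube in dimension \<open>n\<close> is a subset
  of a single type for all \<open>n\<close>.\<close>

definition cube :: "nat \<Rightarrow> (nat \<Rightarrow> real) topology" where
  "cube n = subtopology (Euclidean_space n) {x. \<forall>i<n. 0 \<le> x i \<and> x i \<le> 1}"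

lemma topspace_cube:
  "topspace (cube n) = {x. (\<forall>i<n. 0 \<le> x i \<and> x i \<le> 1) \<and> (\<forall>i\<ge>n. x i = 0)}"
  by (auto simp: cube_def topspace_Euclidean_space)

lemma Hausdorff_space_cube: "Hausdorff_space (cube n)"
  by (simp add: cube_def Hausdorff_space_subtopology Hausdorff_Euclidean_space)

definition homeo_rel :: "'a topology \<Rightarrow> 'a set set \<Rightarrow> ('a set \<times> 'a set) set" where
  "homeo_rel X \<A> = {(A, B). A \<in> \<A> \<and> B \<in> \<A> \<and>
     subtopology X A homeomorphic_space subtopology X B}"

definition C_rel :: "nat \<Rightarrow> ((nat \<Rightarrow> real) set \<times> (nat \<Rightarrow> real) set) set" where
  "C_rel n = homeo_rel (cube n) (space (continua (cube n)))"

definition H_rel :: "nat \<Rightarrow> ((nat \<Rightarrow> real) set \<times> (nat \<Rightarrow> real) set) set" where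
  "H_rel n = homeo_rel (cube n) (space (effros (cube n)))"

definition R_rel :: "nat \<Rightarrow> ((nat \<Rightarrow> real) set \<times> (nat \<Rightarrow> real) set) set" where
  "R_rel n = {(A, B). A \<in> space (effros (cube n)) \<and> B \<in> space (effros (cube n)) \<and>
     (\<exists>f. homeomorphic_map (cube n) (cube n) f \<and> f ` A = B)}"

lemma equiv_homeo_rel: "equiv \<A> (homeo_rel X \<A>)"
proof (rule equivI)
  show "homeo_rel X \<A> \<subseteq> \<A> \<times> \<A>"
    by (auto simp: homeo_rel_def)
  show "refl_on \<A> (homeo_rel X \<A>)"
    by (simp add: refl_on_def homeo_rel_def homeomorphic_space_refl)
  show "sym (homeo_rel X \<A>)"
    unfolding homeo_rel_def sym_def using homeomorphic_space_sym by blast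
  show "trans (homeo_rel X \<A>)"
    unfolding homeo_rel_def trans_def using homeomorphic_space_trans by blast
qed

lemma equiv_C_rel: "equiv (space (continua (cube n))) (C_rel n)"
  and equiv_H_rel: "equiv (space (effros (cube n))) (H_rel n)"
  by (simp_all add: C_rel_def H_rel_def equiv_homeo_rel)

lemma R_rel_iff:
  "(A, B) \<in> R_rel n \<longleftrightarrow> A \<in> space (effros (cube n)) \<and> B \<in> space (effros (cube n)) \<and>
     (\<exists>f. homeomorphic_map (cube n) (cube n) f \<and> f ` A = B)"
  by (simp add: R_rel_def)

lemma equiv_R_rel: "equiv (space (effros (cube n))) (R_rel n)"
proof (rule equivI)
  show "R_rel n \<subseteq> space (effros (cube n)) \<times> space (effros (cube n))"
    by (auto simp: R_rel_def)
  show "refl_on (space (effros (cube n))) (R_rel n)"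
  proof (rule refl_onI)
    fix A assume "A \<in> space (effros (cube n))"
    moreover have "homeomorphic_map (cube n) (cube n) id \<and> id ` A = A"
      by simp
    ultimately show "(A, A) \<in> R_rel n"
      unfolding R_rel_iff by blast
  qed
  show "sym (R_rel n)"
  proof (rule symI)
    fix A B assume AB: "(A, B) \<in> R_rel n"
    then obtain f where f: "homeomorphic_map (cube n) (cube n) f" "f ` A = B"
      unfolding R_rel_iff by blast
    then obtain g where fg: "homeomorphic_maps (cube n) (cube n) f g"
      unfolding homeomorphic_map_maps by blast
    have "A \<subseteq> topspace (cube n)"
      using AB closedin_subset unfolding R_rel_iff space_effros by fast
    then have "g ` B = A"
      using fg unfolding f(2)[symmetric] homeomorphic_maps_def image_image
      by (metis (mono_tags, lifting) image_cong image_ident subsetD)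
    moreover have "homeomorphic_map (cube n) (cube n) g"
      using fg homeomorphic_maps_map by blast
    ultimately show "(B, A) \<in> R_rel n"
      using AB unfolding R_rel_iff by blast
  qed
  show "trans (R_rel n)"
  proof (rule transI)
    fix A B C assume AB: "(A, B) \<in> R_rel n" and BC: "(B, C) \<in> R_rel n"
    then obtain f g where fg: "homeomorphic_map (cube n) (cube n) f" "f ` A = B"
        "homeomorphic_map (cube n) (cube n) g" "g ` B = C"
      unfolding R_rel_iff by blast
    have "homeomorphic_map (cube n) (cube n) (g \<circ> f)"
      using fg(1,3) by (rule homeomorphic_map_compose)
    moreover have "(g \<circ> f) ` A = C"
      using fg(2,4) by (metis image_comp)
    ultimately have "homeomorphic_map (cube n) (cube n) (g \<circ> f) \<and> (g \<circ> f) ` A = C"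
      by blast
    then show "(A, C) \<in> R_rel n"
      using AB BC unfolding R_rel_iff by blast
  qed
qed

definition borel_reducible ::
    "'a measure \<Rightarrow> ('a \<times> 'a) set \<Rightarrow> 'b measure \<Rightarrow> ('b \<times> 'b) set \<Rightarrow> bool" where
  "borel_reducible M E N F \<longleftrightarrow>
     (\<exists>\<phi> \<in> measurable M N. \<forall>x \<in> space M. \<forall>y \<in> space M. (x, y) \<in> E \<longleftrightarrow> (\<phi> x, \<phi> y) \<in> F)"

end

(*
  The double fan over compact A \<subseteq> P \<subseteq> [0,1]^n is the double cone with apexes south and north over
  P, with two sequences of further cones over P attached: one at south and one at north, each
  converging to the half of the double cone next to its apex, and with a copy of A \<times> [0,1] glued to
  the copy of A in the equator.  The apexes are the only points whose removal leaves infinitely many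
  components.  For either apex, close up the part that its removal cuts off from the other apex:
  the two closures meet exactly in the equator P, and what lies in neither of them accumulates on
  the equator exactly at A.  So the homeomorphism type of the double fan determines that of the pair
  (P, A), and conversely.  Parts (1) and (2) are the cases P = A and P = [0,1]^n.

  For (3), A goes to the union of the lower half of [0,1]^(n+1) and copies of A at heights decreasing
  to 1/2.  A homeomorphism of the cube preserves the interior of this set, hence the closure of the
  interior, hence the face at height 1/2, and the remaining copies accumulate on that face exactly
  at A.
*)

theory Submission
  imports Defs
begin

text \<open>\<open>A\<close> is an arbitrary compact set, possibly with infinitely many components,
  so the structure of \<open>A\<close> itself offers no landmarks. Coning cures this: every point of
  the fan is joined to an apex by a path of at most two segments, so deleting a point that is not an
  apex can isolate no more than the part of one segment beyond it, however wild \<open>P\<close> and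
  \<open>A\<close> are. An apex, in contrast, carries infinitely many cones that hang on it alone.
  These cones must accumulate for the fan to be compact, and their limit, half of the central double
  cone, carries the closure of the cut-off part up to the equator. Two apexes are needed because a
  single closure yields cones over P, not P. The two extra dimensions are the height and the slope
  that tells the sheets apart. For (2) the whole cube serves as \<open>P\<close>, since a
  homeomorphism of A onto B need not extend to the cube.

  In (3) a homeomorphism of the larger cube need not respect heights. A copy of the n-cube on which
  it can be restricted has to be found first; the lower half supplies it, being the only part of the
  set that has interior.\<close>

section \<open>Subsets of the cube as subspaces of the type of real sequences\<close>

text \<open>The product topology is the topology of the type \<open>nat \<Rightarrow> real\<close>,
  so all cubes are subspaces of one type, and the type class notions \<open>compact\<close>,
  \<open>connected\<close> and \<open>homeomorphism\<close> can replace those for abstract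
  topologies.\<close>

lemma cube_eq_top_of_set: "cube n = top_of_set (topspace (cube n))"
proof -
  have "cube n = top_of_set ({x. \<forall>i\<ge>n. x i = 0} \<inter> {x. \<forall>i<n. 0 \<le> x i \<and> x i \<le> 1})"
    by (simp add: cube_def Euclidean_space_def euclidean_product_topology subtopology_subtopology)
  also have "{x. \<forall>i\<ge>n. x i = 0} \<inter> {x. \<forall>i<n. 0 \<le> x i \<and> x i \<le> 1} = topspace (cube n)"
    by (auto simp: topspace_cube)
  finally show ?thesis .
qed

lemma compact_topspace_cube: "compact (topspace (cube n))"
proof -
  have "topspace (cube n) = PiE UNIV (\<lambda>i. if i < n then {0..1} else {0::real})"
    by (auto simp: topspace_cube PiE_iff split: if_splits)
  moreover have "compactin (product_topology (\<lambda>i::nat. euclideanreal) UNIV) \<dots>"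
    by (subst compactin_PiE) (auto split: if_splits)
  ultimately show ?thesis
    by (simp add: euclidean_product_topology)
qed

lemma subtopology_cube: "A \<subseteq> topspace (cube n) \<Longrightarrow> subtopology (cube n) A = top_of_set A"
  by (subst cube_eq_top_of_set) (simp add: subtopology_subtopology Int_absorb1)

lemma closedin_cube: "closedin (cube n) A \<longleftrightarrow> compact A \<and> A \<subseteq> topspace (cube n)"
proof -
  have "closedin (cube n) A \<longleftrightarrow> closed A \<and> A \<subseteq> topspace (cube n)"
    by (subst cube_eq_top_of_set)
      (metis closedin_closed_eq closedin_subset compact_imp_closed compact_topspace_cube
        topspace_euclidean_subtopology)
  then show ?thesis
    using closed_subset compact_imp_closed compact_topspace_cube closed_Int_compact
    by (metis inf.absorb_iff1)
qed

lemma space_effros_cube: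
  "space (effros (cube n)) = {F. compact F \<and> F \<subseteq> topspace (cube n) \<and> F \<noteq> {}}"
  by (auto simp: space_effros closedin_cube)

lemma space_continua_cube:
  "space (continua (cube n)) =
    {F. compact F \<and> connected F \<and> F \<subseteq> topspace (cube n) \<and> F \<noteq> {}}"
proof -
  have "compactin (cube n) F \<longleftrightarrow> compact F \<and> F \<subseteq> topspace (cube n)" for F
    by (subst cube_eq_top_of_set) (auto simp: compactin_subtopology)
  moreover have "connectedin (cube n) F \<longleftrightarrow> connected F \<and> F \<subseteq> topspace (cube n)" for F
    by (subst cube_eq_top_of_set) (auto simp: connectedin_subtopology connectedin_iff_connected)
  ultimately show ?thesis
    by (auto simp: space_continua[OF Hausdorff_space_cube])
qed

section \<open>The three equivalence relations in terms of \<open>homeomorphism\<close>\<close>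

lemma homeomorphic_maps_top_of_set:
  "homeomorphic_maps (top_of_set A) (top_of_set B) f g \<longleftrightarrow> homeomorphism A B f g"
proof
  show "homeomorphism A B f g" if "homeomorphic_maps (top_of_set A) (top_of_set B) f g"
    using that by (intro homeomorphismI) (auto simp: homeomorphic_maps_def)
  show "homeomorphic_maps (top_of_set A) (top_of_set B) f g" if "homeomorphism A B f g"
    using that by (auto simp: homeomorphic_maps_def homeomorphism_def)
qed

lemma homeomorphic_space_top_of_set:
  "top_of_set A homeomorphic_space top_of_set B \<longleftrightarrow> A homeomorphic B"
  by (simp add: homeomorphic_space_def homeomorphic_def homeomorphic_maps_top_of_set)

lemma H_rel_iff:
  "(A, B) \<in> H_rel n \<longleftrightarrow>
    A \<in> space (effros (cube n)) \<and> B \<in> space (effros (cube n)) \<and> A homeomorphic B"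
  by (auto simp: H_rel_def homeo_rel_def space_effros_cube subtopology_cube
      homeomorphic_space_top_of_set)

lemma C_rel_iff:
  "(A, B) \<in> C_rel n \<longleftrightarrow>
    A \<in> space (continua (cube n)) \<and> B \<in> space (continua (cube n)) \<and> A homeomorphic B"
  by (auto simp: C_rel_def homeo_rel_def space_continua_cube subtopology_cube
      homeomorphic_space_top_of_set)

lemma R_rel_iff_homeomorphism:
  "(A, B) \<in> R_rel n \<longleftrightarrow>
    A \<in> space (effros (cube n)) \<and> B \<in> space (effros (cube n)) \<and>
    (\<exists>f g. homeomorphism (topspace (cube n)) (topspace (cube n)) f g \<and> f ` A = B)"
proof -
  have "homeomorphic_map (cube n) (cube n) f \<longleftrightarrow>
      (\<exists>g. homeomorphism (topspace (cube n)) (topspace (cube n)) f g)" for f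
    by (metis cube_eq_top_of_set homeomorphic_map_maps homeomorphic_maps_top_of_set)
  then show ?thesis
    by (simp add: R_rel_iff)
qed

text \<open>The image of \<open>A\<close> meets an open \<open>U\<close> iff \<open>K\<close> does
  or \<open>A\<close> meets the union of the preimages of \<open>U\<close> under the
  \<open>f t\<close>. That union is open for any index set \<open>T\<close>, however large, so
  generators pull back to generators or to the whole space.\<close>

lemma measurable_effros_union_images:
  fixes f :: "'t \<Rightarrow> 'a::t2_space \<Rightarrow> 'b::topological_space"
  assumes Y: "\<And>A. A \<in> space (effros (top_of_set S)) \<Longrightarrow>
      K \<union> (\<Union>t\<in>T. f t ` A) \<in> space (effros (top_of_set Y))"
    and f: "\<And>t. t \<in> T \<Longrightarrow> continuous_on S (f t)" "\<And>t. t \<in> T \<Longrightarrow> f t ` S \<subseteq> Y"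
  shows "(\<lambda>A. K \<union> (\<Union>t\<in>T. f t ` A)) \<in> measurable (effros (top_of_set S)) (effros (top_of_set Y))"
proof -
  let ?\<Phi> = "\<lambda>A. K \<union> (\<Union>t\<in>T. f t ` A)"
  show ?thesis
    unfolding effros_def[of "top_of_set Y"]
  proof (rule measurable_measure_of)
    show "?\<Phi> \<in> space (effros (top_of_set S)) \<rightarrow> {F. closedin (top_of_set Y) F \<and> F \<noteq> {}}"
      using Y by (auto simp: space_effros)
    fix y
    assume "y \<in> (\<lambda>U. {F. closedin (top_of_set Y) F \<and> F \<noteq> {} \<and> F \<inter> U \<noteq> {}}) `
      {U. openin (top_of_set Y) U}"
    then obtain U where U: "openin (top_of_set Y) U"
      and y: "y = {F. closedin (top_of_set Y) F \<and> F \<noteq> {} \<and> F \<inter> U \<noteq> {}}"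
      by blast
    define V where "V = (\<Union>t\<in>T. S \<inter> f t -` U)"
    have V: "openin (top_of_set S) V"
      unfolding V_def using f U by (intro openin_Union) (auto intro!: continuous_openin_preimage[where T=Y])
    have "?\<Phi> -` y \<inter> space (effros (top_of_set S)) =
      {A \<in> space (effros (top_of_set S)). ?\<Phi> A \<inter> U \<noteq> {}}"
      using Y by (auto simp: y space_effros)
    also have "\<dots> \<in> sets (effros (top_of_set S))"
    proof (cases "K \<inter> U = {}")
      case True
      have hit: "?\<Phi> A \<inter> U \<noteq> {} \<longleftrightarrow> A \<inter> V \<noteq> {}" if "closedin (top_of_set S) A" for A
        using True closedin_imp_subset[OF that] unfolding V_def by blast
      have "{A \<in> space (effros (top_of_set S)). ?\<Phi> A \<inter> U \<noteq> {}} =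
          {A. closedin (top_of_set S) A \<and> A \<noteq> {} \<and> A \<inter> V \<noteq> {}}"
        unfolding space_effros mem_Collect_eq
        by (rule Collect_cong) (use hit in metis)
      then show ?thesis
        using V by (auto simp: sets_effros intro!: sigma_sets.Basic)
    next
      case False
      then have "{A \<in> space (effros (top_of_set S)). ?\<Phi> A \<inter> U \<noteq> {}} =
          space (effros (top_of_set S))"
        by blast
      then show ?thesis
        by simp
    qed
    finally show "?\<Phi> -` y \<inter> space (effros (top_of_set S)) \<in> sets (effros (top_of_set S))" .
  qed auto
qed

section \<open>Topological invariants used for recognition\<close>

text \<open>Compactness makes \<open>X\<close> and \<open>Y\<close> closed, so closures in the
  ambient types agree with those in the subspaces.\<close>

lemma homeomorphism_image_closure:
  fixes X :: "'a::t2_space set" and Y :: "'b::t2_space set"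
  assumes gh: "homeomorphism X Y g h" and "compact X" and B: "B \<subseteq> X"
  shows "g ` closure B = closure (g ` B)"
proof
  have g: "continuous_on X g" "g ` X = Y" and h: "continuous_on Y h" "h ` Y = X"
    and hg: "\<And>x. x \<in> X \<Longrightarrow> h (g x) = x" and gh': "\<And>y. y \<in> Y \<Longrightarrow> g (h y) = y"
    using gh by (auto simp: homeomorphism_def)
  have "closed X" "closed Y"
    using g \<open>compact X\<close> compact_continuous_image compact_imp_closed by blast+
  then have cl: "closure B \<subseteq> X" "closure (g ` B) \<subseteq> Y"
    using B g(2) closure_minimal[of B X] closure_minimal[of "g ` B" Y] by blast+
  show "g ` closure B \<subseteq> closure (g ` B)"
    using continuous_on_subset[OF g(1) cl(1)] by (rule image_closure_subset) (auto simp: closure_subset)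
  have "h ` g ` B = B"
    using B hg by (force simp: image_image)
  then have "h ` closure (g ` B) \<subseteq> closure B"
    using continuous_on_subset[OF h(1) cl(2)] closure_subset[of B]
    by (intro image_closure_subset) auto
  moreover have "y = g (h y)" if "y \<in> closure (g ` B)" for y
    using cl(2) gh' that by auto
  ultimately show "closure (g ` B) \<subseteq> g ` closure B"
    by blast
qed

lemma homeomorphism_image_connected_component:
  assumes gh: "homeomorphism S T g h" and "x \<in> S"
  shows "g ` connected_component_set S x = connected_component_set T (g x)"
proof -
  \<comment> \<open>Stated for fresh types, so that it applies to the inverse homeomorphism as
    well.\<close>
  have sub: "g ` connected_component_set S x \<subseteq> connected_component_set T (g x)"
    if "homeomorphism S T g h" "x \<in> S" for S :: "'x::topological_space set"
      and T :: "'y::topological_space set" and g h x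
  proof (rule connected_component_maximal)
    have C: "connected_component_set S x \<subseteq> S"
      by (rule connected_component_subset)
    have g: "continuous_on S g" "g ` S = T"
      using that by (auto simp: homeomorphism_def)
    show "connected (g ` connected_component_set S x)"
      using continuous_on_subset[OF g(1) C] by (rule connected_continuous_image) simp
    show "g ` connected_component_set S x \<subseteq> T"
      using C g(2) by blast
    show "g x \<in> g ` connected_component_set S x"
      using that by simp
  qed
  have "g x \<in> T" "h (g x) = x"
    using assms by (auto simp: homeomorphism_def)
  then have "h ` connected_component_set T (g x) \<subseteq> connected_component_set S x"
    using sub[OF homeomorphism_symD[OF gh], of "g x"] by simp
  then have "g ` h ` connected_component_set T (g x) \<subseteq> g ` connected_component_set S x"
    by (rule image_mono)
  moreover have "g ` h ` C = C" if "C \<subseteq> T" for C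
    using gh that by (auto simp: homeomorphism_def image_image subset_iff)
  ultimately show ?thesis
    using sub[OF assms] connected_component_subset[of T "g x"] by auto
qed

text \<open>Equivalent to having finitely many components. With covers, a proof only has to exhibit
  connected pieces, which may overlap and need not be whole components.\<close>

definition finitely_connected :: "'a::topological_space set \<Rightarrow> bool" where
  "finitely_connected S \<longleftrightarrow> (\<exists>\<M>. finite \<M> \<and> (\<forall>M\<in>\<M>. connected M) \<and> \<Union>\<M> = S)"

lemma finitely_connected_continuous_image:
  assumes "continuous_on S g" "finitely_connected S"
  shows "finitely_connected (g ` S)"
proof -
  obtain \<M> where \<M>: "finite \<M>" "\<And>M. M \<in> \<M> \<Longrightarrow> connected M" "\<Union>\<M> = S"
    using assms(2) by (auto simp: finitely_connected_def)
  then have "finite ((`) g ` \<M>)" "\<Union>((`) g ` \<M>) = g ` S"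
    by auto
  moreover have "connected M" if "M \<in> (`) g ` \<M>" for M
  proof -
    obtain N where N: "N \<in> \<M>" "M = g ` N"
      using \<open>M \<in> (`) g ` \<M>\<close> by blast
    have "continuous_on N g"
      using N(1) \<M>(3) by (intro continuous_on_subset[OF assms(1)]) blast
    then show ?thesis
      using N \<M>(2) by (simp add: connected_continuous_image)
  qed
  ultimately show ?thesis
    unfolding finitely_connected_def by (intro exI[of _ "(`) g ` \<M>"]) simp
qed

definition shattering :: "'a::topological_space set \<Rightarrow> 'a set" where
  "shattering X = {p \<in> X. \<not> finitely_connected (X - {p})}"

lemma homeomorphism_Diff_singleton:
  assumes "homeomorphism X Y g h" "p \<in> X"
  shows "homeomorphism (X - {p}) (Y - {g p}) g h"
proof (rule homeomorphism_of_subsets[OF assms(1)])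
  show "g ` (X - {p}) = Y - {g p}"
    using assms inj_on_image_set_diff[of g X X "{p}"] inj_on_inverseI[of X h g]
    by (simp add: homeomorphism_def)
qed auto

lemma homeomorphism_image_shattering:
  assumes gh: "homeomorphism X Y g h"
  shows "g ` shattering X = shattering Y"
proof -
  have fc: "finitely_connected (Y - {g p})"
    if "homeomorphism X Y g h" "p \<in> X" "finitely_connected (X - {p})"
    for X :: "'x::topological_space set" and Y :: "'y::topological_space set" and g h p
  proof -
    have "continuous_on (X - {p}) g" "g ` (X - {p}) = Y - {g p}"
      using homeomorphism_Diff_singleton[OF that(1,2)] by (auto simp: homeomorphism_def)
    then show ?thesis
      using finitely_connected_continuous_image[of "X - {p}" g] that(3) by simp
  qed
  have "finitely_connected (Y - {g p}) \<longleftrightarrow> finitely_connected (X - {p})" if "p \<in> X" for p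
  proof -
    have "g p \<in> Y" "h (g p) = p"
      using gh that by (auto simp: homeomorphism_def)
    then show ?thesis
      using fc[OF gh that] fc[OF homeomorphism_symD[OF gh], of "g p"] by auto
  qed
  then have "g ` shattering X = {y \<in> g ` X. \<not> finitely_connected (Y - {y})}"
    by (auto simp: shattering_def)
  also have "g ` X = Y"
    using gh by (simp add: homeomorphism_def)
  finally show ?thesis
    by (simp add: shattering_def)
qed

text \<open>Intended for points \<open>p\<close>, \<open>q\<close> of \<open>X\<close>: the closure of what the removal of \<open>p\<close> cuts off from \<open>q\<close>.\<close>

definition branch_closure :: "'a::topological_space set \<Rightarrow> 'a \<Rightarrow> 'a \<Rightarrow> 'a set" where
  "branch_closure X p q = closure (X - {p} - connected_component_set (X - {p}) q)"

lemma homeomorphism_image_branch_closure: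
  fixes X :: "'a::t2_space set" and Y :: "'b::t2_space set"
  assumes gh: "homeomorphism X Y g h" and "compact X" and pq: "p \<in> X" "q \<in> X" "p \<noteq> q"
  shows "g ` branch_closure X p q = branch_closure Y (g p) (g q)"
proof -
  have gh': "homeomorphism (X - {p}) (Y - {g p}) g h"
    using gh pq(1) by (rule homeomorphism_Diff_singleton)
  have inj: "inj_on g (X - {p})"
    using gh' by (intro inj_on_inverseI[where g=h]) (simp add: homeomorphism_def)
  have "connected_component_set (X - {p}) q \<subseteq> X - {p}"
    by (rule connected_component_subset)
  then have "g ` (X - {p} - connected_component_set (X - {p}) q) =
      Y - {g p} - connected_component_set (Y - {g p}) (g q)"
    using homeomorphism_image_connected_component[OF gh', of q] homeomorphism_image1[OF gh'] pq
    by (subst inj_on_image_set_diff[OF inj]) auto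
  then show ?thesis
    unfolding branch_closure_def
    using homeomorphism_image_closure[OF gh \<open>compact X\<close>, of "X - {p} - connected_component_set (X - {p}) q"]
    by (simp add: Diff_subset subset_trans[OF Diff_subset])
qed

lemma connected_component_if_connected_subset:
  "connected C \<Longrightarrow> q \<in> C \<Longrightarrow> z \<in> C \<Longrightarrow> C \<subseteq> S \<Longrightarrow> z \<in> connected_component_set S q"
  using connected_component_maximal by blast

text \<open>For the apexes of a double fan this gives the copy of \<open>P\<close>, and
  \<open>marked_spine\<close> the copy of \<open>A\<close>. Both are symmetric in \<open>p\<close>
  and \<open>q\<close>, so a homeomorphism that swaps the apexes does no harm.\<close>

definition spine :: "'a::topological_space set \<Rightarrow> 'a \<Rightarrow> 'a \<Rightarrow> 'a set" where
  "spine X p q = branch_closure X p q \<inter> branch_closure X q p"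

definition marked_spine :: "'a::topological_space set \<Rightarrow> 'a \<Rightarrow> 'a \<Rightarrow> 'a set" where
  "marked_spine X p q =
    spine X p q \<inter> closure (X - branch_closure X p q - branch_closure X q p)"

lemma spine_commute: "spine X p q = spine X q p"
  by (simp add: spine_def Int_commute)

lemma marked_spine_commute: "marked_spine X p q = marked_spine X q p"
proof -
  have "X - branch_closure X p q - branch_closure X q p = X - branch_closure X q p - branch_closure X p q"
    by blast
  then show ?thesis
    unfolding marked_spine_def spine_commute[of X p q] by (rule arg_cong)
qed

section \<open>The double fan over a pair of compact sets\<close>

text \<open>The factor by which the base of the double cone is shrunk at height \<open>s\<close>; it
  vanishes exactly at the apexes.\<close>

definition hgt :: "real \<Rightarrow> real" where
  "hgt s = min s (1 - s)"

lemma hgt_reflect [simp]: "hgt (1 - s) = hgt s"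
  by (simp add: hgt_def min.commute)

lemma hgt_pos: "0 < hgt s \<longleftrightarrow> 0 < s \<and> s < 1"
  by (auto simp: hgt_def)

lemma hgt_simps [simp]: "hgt 0 = 0" "hgt 1 = 0" "hgt (1/2) = 1/2"
  by (simp_all add: hgt_def)

lemma hgt_bounds: "0 \<le> s \<Longrightarrow> s \<le> 1 \<Longrightarrow> 0 \<le> hgt s \<and> hgt s \<le> 1"
  by (auto simp: hgt_def)

text \<open>Decreases from 1 to the limit 1/2: the values fit into the unit interval, and those
  below 1/2 stay free for the arm over \<open>A\<close>. The same sequence gives the heights of the
  copies of \<open>A\<close> in part (3).\<close>

definition slope :: "nat \<Rightarrow> real" where
  "slope k = 1/2 + 1 / (real k + 2)"

lemma slope_bounds: "1/2 < slope k" "slope k \<le> 1"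
  by (simp_all add: slope_def field_simps)

lemma slope_less_iff: "slope j < slope k \<longleftrightarrow> k < j"
  by (simp add: slope_def field_simps)

lemma inj_slope: "inj slope"
  by (rule injI) (metis less_irrefl linorder_neqE_nat slope_less_iff)

text \<open>The bound \<open>1/2 \<le> l\<close> separates \<open>slope k\<close> from the central
  sheet and the arm too, not only from the other slopes.\<close>

lemma slope_isolated:
  obtains l u where "1/2 \<le> l" "l < slope k" "slope k < u" "\<And>j. l < slope j \<Longrightarrow> slope j < u \<Longrightarrow> j = k"
proof
  \<comment> \<open>The upper bound is \<open>slope (k - 1)\<close>, written out so that
    \<open>k = 0\<close> needs no separate case; there it equals 2 - 1/2 = 3/2.\<close>
  show "1/2 \<le> slope (Suc k)" "slope (Suc k) < slope k" "slope k < 1/2 + 1 / (real k + 1)"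
    by (simp_all add: slope_def field_simps)
  fix j assume "slope (Suc k) < slope j" "slope j < 1/2 + 1 / (real k + 1)"
  then show "j = k"
    by (simp add: slope_less_iff) (simp add: slope_def field_simps)
qed

definition fan_slopes :: "bool \<Rightarrow> real set" where
  "fan_slopes b = insert (1/2) (slope ` {k. even k = b})"

lemma slope_in_fan_slopes: "slope k \<in> fan_slopes b \<longleftrightarrow> even k = b"
  using slope_bounds(1)[of k] inj_slope by (auto simp: fan_slopes_def inj_def)

lemma fan_slopes_cases:
  assumes "c \<in> fan_slopes b"
  obtains "c = 1/2" | k where "even k = b" "c = slope k"
  using assms by (auto simp: fan_slopes_def)

lemma half_in_fan_slopes [simp]: "1/2 \<in> fan_slopes b"
  by (simp add: fan_slopes_def)

lemma fan_slopes_bounds: "c \<in> fan_slopes b \<Longrightarrow> 1/2 \<le> c \<and> c \<le> 1"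
  using slope_bounds less_imp_le by (auto simp: fan_slopes_def)

lemma slope_sequence: "slope ` {k. even k = b} = range (\<lambda>j. slope (2 * j + of_bool (\<not> b)))"
proof -
  have "{k::nat. even k = b} = range (\<lambda>j. 2 * j + of_bool (\<not> b))"
    by (cases b) (auto elim!: evenE oddE, presburger)
  then show ?thesis
    by (simp add: image_image)
qed

lemma slope_tendsto: "slope \<longlonglongrightarrow> 1/2"
proof -
  have "slope = (\<lambda>k. 1/2 + inverse (real (Suc (Suc k))))"
    by (simp add: slope_def fun_eq_iff inverse_eq_divide add.commute)
  then show ?thesis
    using LIMSEQ_Suc[OF LIMSEQ_inverse_real_of_nat_add[of "1/2"]] by simp
qed

lemma slope_subsequence_tendsto: "(\<lambda>j. slope (2 * j + of_bool b)) \<longlonglongrightarrow> 1/2"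
  using slope_tendsto by (auto intro!: LIMSEQ_subseq_LIMSEQ[unfolded comp_def] simp: strict_mono_def)

lemma compact_fan_slopes: "compact (fan_slopes b)"
  unfolding fan_slopes_def slope_sequence
  by (rule compact_sequence_with_limit) (rule slope_subsequence_tendsto)

lemma closure_slopes: "closure (slope ` {k. even k = b}) = fan_slopes b"
proof
  show "closure (slope ` {k. even k = b}) \<subseteq> fan_slopes b"
    by (intro closure_minimal compact_imp_closed compact_fan_slopes) (auto simp: fan_slopes_def)
  have "1/2 \<in> closure (slope ` {k. even k = b})"
    unfolding slope_sequence closure_sequential
    using slope_subsequence_tendsto[of "\<not> b"]
    by (intro exI[of _ "\<lambda>j. slope (2 * j + of_bool (\<not> b))"]) simp
  then show "fan_slopes b \<subseteq> closure (slope ` {k. even k = b})"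
    using closure_subset[of "slope ` {k. even k = b}"] by (simp add: fan_slopes_def)
qed

text \<open>A double cone over [0,1]^n x [0,1] inside [0,1]^(n+2): the base point
  \<open>(a, c)\<close> is shrunk by \<open>hgt s\<close>, and the last coordinate records the
  height. At \<open>s = 0\<close> and \<open>s = 1\<close> the base collapses to an apex.\<close>

definition pt :: "nat \<Rightarrow> (nat \<Rightarrow> real) \<Rightarrow> real \<Rightarrow> real \<Rightarrow> nat \<Rightarrow> real" where
  "pt n a c s =
    (\<lambda>i. if i < n then hgt s * a i else if i = n then hgt s * c else if i = Suc n then s else 0)"

lemma pt_simps [simp]:
  "i < n \<Longrightarrow> pt n a c s i = hgt s * a i" "pt n a c s n = hgt s * c" "pt n a c s (Suc n) = s"
  by (simp_all add: pt_def)

lemma continuous_on_pt [continuous_intros]: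
  assumes "continuous_on S f" "continuous_on S g" "continuous_on S h"
  shows "continuous_on S (\<lambda>x. pt n (f x) (g x) (h x))"
proof (rule continuous_on_coordinatewise_then_product)
  fix i
  show "continuous_on S (\<lambda>x. pt n (f x) (g x) (h x) i)"
    using assms continuous_on_product_then_coordinatewise[OF assms(1), of i]
    unfolding pt_def hgt_def
    by (cases "i < n"; cases "i = n"; cases "i = Suc n") (auto intro!: continuous_intros)
qed

definition south :: "nat \<Rightarrow> real" where
  "south = (\<lambda>i. 0)"

definition north :: "nat \<Rightarrow> nat \<Rightarrow> real" where
  "north n = (\<lambda>i. if i = Suc n then 1 else 0)"

lemma pt_poles [simp]: "pt n a c 0 = south" "pt n a c 1 = north n"
  by (auto simp: pt_def south_def north_def)

lemma pt_eq_pole_iff: "pt n a c s = south \<longleftrightarrow> s = 0" "pt n a c s = north n \<longleftrightarrow> s = 1"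
  by (metis pt_simps(3) pt_poles)+

lemma north_neq_south [simp]: "north n \<noteq> south" "south \<noteq> north n"
  by (auto simp: north_def south_def fun_eq_iff)

text \<open>The height is a coordinate, and away from the apexes its positive factor
  \<open>hgt s\<close> can be cancelled.\<close>

lemma pt_eq_iff:
  assumes "a \<in> topspace (cube n)" "a' \<in> topspace (cube n)" "0 < s" "s < 1"
  shows "pt n a c s = pt n a' c' s' \<longleftrightarrow> a = a' \<and> c = c' \<and> s = s'"
proof
  assume eq: "pt n a c s = pt n a' c' s'"
  have s: "s' = s"
    using fun_cong[OF eq, of "Suc n"] by simp
  have "hgt s > 0"
    using assms by (simp add: hgt_pos)
  then have "c = c'" "\<And>i. i < n \<Longrightarrow> a i = a' i"
    using fun_cong[OF eq, of n] fun_cong[OF eq] unfolding s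
    by (simp, metis mult_cancel_left less_irrefl pt_simps(1))
  moreover have "a i = a' i" if "\<not> i < n" for i
    using assms that by (simp add: topspace_cube)
  ultimately show "a = a' \<and> c = c' \<and> s = s'"
    using s by (auto simp: fun_eq_iff)
qed simp

lemma pt_in_cube:
  assumes "a \<in> topspace (cube n)" "0 \<le> c" "c \<le> 1" "0 \<le> s" "s \<le> 1"
  shows "pt n a c s \<in> topspace (cube (n + 2))"
  using assms hgt_bounds[of s] by (auto simp: topspace_cube pt_def mult_le_one)

definition reflect :: "nat \<Rightarrow> (nat \<Rightarrow> real) \<Rightarrow> nat \<Rightarrow> real" where
  "reflect n x = x(Suc n := 1 - x (Suc n))"

lemma reflect_pt: "reflect n (pt n a c s) = pt n a c (1 - s)"
  by (auto simp: reflect_def pt_def)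

lemma reflect_reflect [simp]: "reflect n (reflect n x) = x"
  by (simp add: reflect_def)

lemma reflect_poles [simp]: "reflect n south = north n" "reflect n (north n) = south"
  by (auto simp: reflect_def south_def north_def)

lemma continuous_on_reflect: "continuous_on S (reflect n)"
proof (rule continuous_on_coordinatewise_then_product)
  fix i
  show "continuous_on S (\<lambda>x. reflect n x i)"
    by (cases "i = Suc n")
      (auto simp: reflect_def intro!: continuous_intros continuous_on_product_then_coordinatewise[where f="\<lambda>x. x"])
qed

text \<open>A point of the double fan has cone coordinates \<open>(a, c, s)\<close>: height \<open>s\<close>, with \<open>s = 0\<close> and
  \<open>s = 1\<close> the two apexes, and \<open>c\<close> selecting the sheet, where \<open>c = 1/2\<close> is the central double cone,
  \<open>c > 1/2\<close> are the attached cones, and \<open>c < 1/2\<close> is the arm over \<open>A\<close>. The slopes are split by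
  parity between the two apexes, so that cones of different apexes do not meet at \<open>s = 1/2\<close>;
  \<open>b\<close> tells which parity belongs to south, and reflection in \<open>s = 1/2\<close> flips it.\<close>

definition params ::
    "bool \<Rightarrow> (nat \<Rightarrow> real) set \<Rightarrow> (nat \<Rightarrow> real) set \<Rightarrow> ((nat \<Rightarrow> real) \<times> real \<times> real) set" where
  "params b P A = P \<times> fan_slopes b \<times> {0..1/2} \<union> P \<times> fan_slopes (\<not> b) \<times> {1/2..1} \<union>
    A \<times> {0..1/2} \<times> {1/2}"

definition double_fan ::
    "nat \<Rightarrow> bool \<Rightarrow> (nat \<Rightarrow> real) set \<Rightarrow> (nat \<Rightarrow> real) set \<Rightarrow> (nat \<Rightarrow> real) set" where
  "double_fan n b P A = (\<lambda>(a, c, s). pt n a c s) ` params b P A"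

section \<open>The fan of a fixed pair: membership, compactness, symmetry\<close>

locale cube_pair =
  fixes n :: nat and P A :: "(nat \<Rightarrow> real) set"
  assumes compact_P: "compact P" and compact_A: "compact A"
    and A_subset: "A \<subseteq> P" and P_subset: "P \<subseteq> topspace (cube n)" and A_nonempty: "A \<noteq> {}"
begin

abbreviation X :: "bool \<Rightarrow> (nat \<Rightarrow> real) set" where
  "X b \<equiv> double_fan n b P A"

lemma left_in_X: "a \<in> P \<Longrightarrow> c \<in> fan_slopes b \<Longrightarrow> 0 \<le> s \<Longrightarrow> s \<le> 1/2 \<Longrightarrow> pt n a c s \<in> X b"
  unfolding double_fan_def params_def by (rule image_eqI[of _ _ "(a, c, s)"]) auto

lemma right_in_X:
  "a \<in> P \<Longrightarrow> c \<in> fan_slopes (\<not> b) \<Longrightarrow> 1/2 \<le> s \<Longrightarrow> s \<le> 1 \<Longrightarrow> pt n a c s \<in> X b"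
  unfolding double_fan_def params_def by (rule image_eqI[of _ _ "(a, c, s)"]) auto

lemma arm_in_X: "a \<in> A \<Longrightarrow> 0 \<le> c \<Longrightarrow> c \<le> 1/2 \<Longrightarrow> pt n a c (1/2) \<in> X b"
  unfolding double_fan_def params_def by (rule image_eqI[of _ _ "(a, c, 1/2)"]) auto

lemma base_in_X: "a \<in> P \<Longrightarrow> 0 \<le> s \<Longrightarrow> s \<le> 1 \<Longrightarrow> pt n a (1/2) s \<in> X b"
  by (cases "s \<le> 1/2") (auto intro: left_in_X right_in_X)

lemma in_X_cases:
  assumes "x \<in> X b"
  obtains (left) a c s where "x = pt n a c s" "a \<in> P" "c \<in> fan_slopes b" "0 \<le> s" "s \<le> 1/2"
    | (right) a c s where "x = pt n a c s" "a \<in> P" "c \<in> fan_slopes (\<not> b)" "1/2 \<le> s" "s \<le> 1"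
    | (arm) a c where "x = pt n a c (1/2)" "a \<in> A" "0 \<le> c" "c \<le> 1/2"
proof -
  obtain a c s where x: "x = pt n a c s" and "(a, c, s) \<in> params b P A"
    using assms by (auto simp: double_fan_def)
  then consider "(a, c, s) \<in> P \<times> fan_slopes b \<times> {0..1/2}"
    | "(a, c, s) \<in> P \<times> fan_slopes (\<not> b) \<times> {1/2..1}" | "(a, c, s) \<in> A \<times> {0..1/2} \<times> {1/2}"
    unfolding params_def by blast
  then show thesis
  proof cases
    case 1
    then show ?thesis using left[OF x] by simp
  next
    case 2
    then show ?thesis using right[OF x] by simp
  next
    case 3
    then have "s = 1/2" by simp
    with 3 x show ?thesis using arm[of a c] unfolding \<open>s = 1/2\<close> by simp
  qed
qed

lemma inject:
  assumes "a \<in> P" "a' \<in> P" "0 < s" "s < 1"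
  shows "pt n a c s = pt n a' c' s' \<longleftrightarrow> a = a' \<and> c = c' \<and> s = s'"
  using assms P_subset by (intro pt_eq_iff) auto

lemma poles_in_X [simp]: "south \<in> X b" "north n \<in> X b"
proof -
  obtain a where "a \<in> P"
    using A_nonempty A_subset by blast
  then show "south \<in> X b" "north n \<in> X b"
    using base_in_X[of a 0 b] base_in_X[of a 1 b] by simp_all
qed

lemma compact_params: "compact (params b P A)"
  unfolding params_def
  by (intro compact_Un compact_Times compact_P compact_A compact_fan_slopes compact_Icc) simp

lemma continuous_on_pt_params: "continuous_on S (\<lambda>(a, c, s). pt n a c s)"
  unfolding case_prod_beta by (intro continuous_intros)

lemma compact_X: "compact (X b)"
  unfolding double_fan_def
  by (intro compact_continuous_image continuous_on_pt_params compact_params)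

lemma X_subset_cube: "X b \<subseteq> topspace (cube (n + 2))"
proof
  fix x assume "x \<in> X b"
  then show "x \<in> topspace (cube (n + 2))"
  proof (cases rule: in_X_cases)
    case left
    then show ?thesis
      using P_subset fan_slopes_bounds[OF left(3)] unfolding left(1) by (intro pt_in_cube) auto
  next
    case right
    then show ?thesis
      using P_subset fan_slopes_bounds[OF right(3)] unfolding right(1) by (intro pt_in_cube) auto
  next
    case arm
    then show ?thesis
      using P_subset A_subset unfolding arm(1) by (intro pt_in_cube) auto
  qed
qed

text \<open>Facts about \<open>north n\<close> follow from those about \<open>south\<close> through
  this symmetry. As it exchanges the parities, the facts are proved for both values of
  \<open>b\<close>.\<close>

lemma homeomorphism_reflect: "homeomorphism (X b) (X (\<not> b)) (reflect n) (reflect n)"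
proof -
  have "reflect n ` X b \<subseteq> X (\<not> b)" for b
  proof (rule image_subsetI)
    fix x assume "x \<in> X b"
    then show "reflect n x \<in> X (\<not> b)"
    proof (cases rule: in_X_cases)
      case (left a c s)
      then show ?thesis by (simp add: reflect_pt right_in_X)
    next
      case (right a c s)
      then show ?thesis by (simp add: reflect_pt left_in_X)
    next
      case (arm a c)
      then show ?thesis using arm_in_X[of a c "\<not> b"] by (simp add: reflect_pt)
    qed
  qed
  from this[of b] this[of "\<not> b"] show ?thesis
    by (intro homeomorphismI continuous_on_reflect) auto
qed

section \<open>Connectedness, and deletion of a point that is not an apex\<close>

lemma to_south_left:
  assumes "a \<in> P" "c \<in> fan_slopes b" "0 \<le> s" "s \<le> 1/2" "p \<notin> pt n a c ` {0..s}"
  shows "pt n a c s \<in> connected_component_set (X b - {p}) south"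
proof (rule connected_component_if_connected_subset)
  show "connected (pt n a c ` {0..s})"
    by (intro connected_continuous_image continuous_intros) auto
  show "south \<in> pt n a c ` {0..s}"
    using assms by (intro image_eqI[of _ _ 0]) auto
qed (use assms in \<open>auto intro!: left_in_X\<close>)

lemma to_north_right:
  assumes "a \<in> P" "c \<in> fan_slopes (\<not> b)" "1/2 \<le> s" "s \<le> 1" "p \<notin> pt n a c ` {s..1}"
  shows "pt n a c s \<in> connected_component_set (X b - {p}) (north n)"
proof (rule connected_component_if_connected_subset)
  show "connected (pt n a c ` {s..1})"
    by (intro connected_continuous_image continuous_intros) auto
  show "north n \<in> pt n a c ` {s..1}"
    using assms by (intro image_eqI[of _ _ 1]) auto
qed (use assms in \<open>auto intro!: right_in_X\<close>)

lemma to_north_base: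
  assumes "a \<in> P" "0 \<le> s" "s \<le> 1" "p \<notin> pt n a (1/2) ` {s..1}"
  shows "pt n a (1/2) s \<in> connected_component_set (X b - {p}) (north n)"
proof (rule connected_component_if_connected_subset)
  show "connected (pt n a (1/2) ` {s..1})"
    by (intro connected_continuous_image continuous_intros) auto
  show "north n \<in> pt n a (1/2) ` {s..1}"
    using assms by (intro image_eqI[of _ _ 1]) auto
qed (use assms in \<open>auto intro!: base_in_X\<close>)

text \<open>The path follows the arm to the equator and then the central cone up to the
  apex.\<close>

lemma to_north_arm:
  assumes "a \<in> A" "0 \<le> c" "c \<le> 1/2" "p \<notin> (\<lambda>c. pt n a c (1/2)) ` {c..1/2}"
    "p \<notin> pt n a (1/2) ` {1/2..1}"
  shows "pt n a c (1/2) \<in> connected_component_set (X b - {p}) (north n)"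
proof -
  have "a \<in> P"
    using assms A_subset by blast
  then have base: "pt n a (1/2) (1/2) \<in> connected_component_set (X b - {p}) (north n)"
    using assms by (intro to_north_base) auto
  have "pt n a c (1/2) \<in> connected_component_set (X b - {p}) (pt n a (1/2) (1/2))"
  proof (rule connected_component_if_connected_subset)
    show "connected ((\<lambda>c. pt n a c (1/2)) ` {c..1/2})"
      by (intro connected_continuous_image continuous_intros) auto
  qed (use assms in \<open>auto intro!: arm_in_X\<close>)
  then show ?thesis
    using connected_component_eq[OF base] by simp
qed

lemma connected_X: "connected (X b)"
proof -
  \<comment> \<open>Removing a point outside \<open>X b\<close> makes the lemmas on connecting points to the apexes applicable.\<close>
  define w :: "nat \<Rightarrow> real" where "w = (\<lambda>i. 2)"
  have no: "w \<noteq> pt n a c s" for a c s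
  proof
    assume "w = pt n a c s"
    then have "w (Suc (Suc n)) = pt n a c s (Suc (Suc n))"
      by simp
    then show False
      by (simp add: w_def pt_def)
  qed
  then have no_image: "w \<notin> pt n a c ` S" "w \<notin> (\<lambda>c. pt n a c s) ` S" for a c s S
    by blast+
  have "w \<notin> X b"
  proof
    assume "w \<in> X b"
    then show False
      by (rule in_X_cases) (use no in blast)+
  qed
  then have eq: "X b - {w} = X b"
    by blast
  obtain a where "a \<in> P"
    using A_nonempty A_subset by blast
  then have "pt n a (1/2) 0 \<in> connected_component_set (X b - {w}) (north n)"
    using no_image by (intro to_north_base) auto
  then have ns: "connected_component_set (X b) (north n) = connected_component_set (X b) south"
    unfolding eq pt_poles by (rule connected_component_eq[symmetric])
  have "X b \<subseteq> connected_component_set (X b) (north n)"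
  proof
    fix x assume "x \<in> X b"
    then show "x \<in> connected_component_set (X b) (north n)"
    proof (cases rule: in_X_cases)
      case (left a c s)
      then have "pt n a c s \<in> connected_component_set (X b - {w}) south"
        using no_image by (intro to_south_left) auto
      then show ?thesis
        unfolding eq ns left(1) .
    next
      case (right a c s)
      then have "pt n a c s \<in> connected_component_set (X b - {w}) (north n)"
        using no_image by (intro to_north_right) auto
      then show ?thesis
        unfolding eq right(1) .
    next
      case (arm a c)
      then have "pt n a c (1/2) \<in> connected_component_set (X b - {w}) (north n)"
        using no_image by (intro to_north_arm) auto
      then show ?thesis
        unfolding eq arm(1) .
    qed
  qed
  then have "connected_component_set (X b) (north n) = X b"
    using connected_component_subset[of "X b" "north n"] by (rule subset_antisym[rotated])
  then show ?thesis
    using connected_connected_component[of "X b" "north n"] by simp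
qed

lemma in_X_params:
  assumes "x \<in> X b"
  shows "\<exists>a c s. x = pt n a c s \<and> 0 \<le> s"
  using assms
proof (cases rule: in_X_cases)
  case (left a c s)
  then show ?thesis by blast
next
  case (right a c s)
  then show ?thesis by (intro exI[of _ a] exI[of _ c] exI[of _ s]) simp
next
  case (arm a c)
  then show ?thesis by (intro exI[of _ a] exI[of _ c] exI[of _ "1/2"]) simp
qed

text \<open>Each remaining point has a path to an apex as above. If \<open>p\<close> blocks it, the
  point lies beyond \<open>p\<close> on the one segment \<open>M\<close>. So the components of the
  two apexes and \<open>M\<close> cover everything.\<close>

lemma finitely_connected_Diff_left:
  assumes p: "p \<in> X b" "p \<noteq> south" "p (Suc n) \<le> 1/2"
  shows "finitely_connected (X b - {p})"
proof -
  obtain a c s where pt: "p = pt n a c s" and s: "0 < s" "s \<le> 1/2" and a: "a \<in> P"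
    and fan: "s < 1/2 \<Longrightarrow> c \<in> fan_slopes b"
  proof (cases rule: in_X_cases[OF p(1)])
    case (1 a c s)
    then show ?thesis
      using that[of a c s] p(2) pt_eq_pole_iff(1)[of n a c s] by auto
  next
    case (2 a c s)
    then show ?thesis
      using that[of a c s] p(3) by auto
  next
    case (3 a c)
    then show ?thesis
      using that[of a c "1/2"] A_subset by auto
  qed
  have s1: "s < 1"
    using s by simp
  note p_eq = inject[OF a _ s(1) s1]
  \<comment> \<open>The outer part of the segment through \<open>p\<close>, or the free part of the
    arm if \<open>p\<close> lies at height 1/2 over \<open>A\<close>. For \<open>c > 1/2\<close> the
    latter is the whole arm, which does no harm: \<open>M\<close> only has to be connected and to
    avoid \<open>p\<close>.\<close>
  define M where "M = (if s < 1/2 then pt n a c ` {s<..1/2}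
    else if a \<in> A then (\<lambda>c'. pt n a c' (1/2)) ` ({0..1/2} \<inter> {..<c}) else {})"
  have conn: "connected M"
  proof -
    have "connected (pt n a c ` {s<..1/2})"
      by (intro connected_continuous_image continuous_intros) auto
    moreover have "connected ((\<lambda>c'. pt n a c' (1/2)) ` ({0..1/2} \<inter> {..<c}))"
      by (intro connected_continuous_image continuous_intros convex_connected convex_Int) auto
    ultimately show ?thesis
      by (simp add: M_def)
  qed
  have sub: "M \<subseteq> X b - {p}"
  proof (cases "s < 1/2")
    case True
    have "pt n a c s' \<in> X b" "pt n a c s' \<noteq> p" if "s < s'" "s' \<le> 1/2" for s'
      using left_in_X[OF a fan[OF True], of s'] that s p_eq[OF a, of c c s'] pt by auto
    then show ?thesis
      using True by (simp add: M_def image_subset_iff)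
  next
    case False
    then have "s = 1/2"
      using s by simp
    have "pt n a c' (1/2) \<in> X b" "pt n a c' (1/2) \<noteq> p" if "a \<in> A" "0 \<le> c'" "c' \<le> 1/2" "c' < c" for c'
      using arm_in_X[of a c' b] that p_eq[OF a, of c c' "1/2"] pt by auto
    then show ?thesis
      using False by (simp add: M_def image_subset_iff)
  qed
  have "X b - {p} \<subseteq> connected_component_set (X b - {p}) south \<union>
      connected_component_set (X b - {p}) (north n) \<union> M"
  proof
    fix z assume "z \<in> X b - {p}"
    then have "z \<in> X b" "z \<noteq> p"
      by auto
    from this(1) show "z \<in> connected_component_set (X b - {p}) south \<union>
      connected_component_set (X b - {p}) (north n) \<union> M"
    proof (cases rule: in_X_cases)
      case (left a' c' s')
      show ?thesis
      proof (cases "p \<in> pt n a' c' ` {0..s'}")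
        case True
        then have "a' = a" "c' = c" "s \<le> s'"
          using p_eq[OF left(2)] by (auto simp: pt)
        then have "s < s'"
          using \<open>z \<noteq> p\<close> left(1) pt by (cases "s = s'") auto
        then have "z \<in> M"
          using left \<open>a' = a\<close> \<open>c' = c\<close> by (simp add: M_def)
        then show ?thesis
          by blast
      next
        case False
        then show ?thesis
          unfolding left(1) using to_south_left[OF left(2-5)] by blast
      qed
    next
      case (right a' c' s')
      \<comment> \<open>This path starts at height \<open>s' \<ge> 1/2 \<ge> s\<close>, so
        \<open>p\<close> could only be its starting point \<open>z\<close>.\<close>
      have "p \<notin> pt n a' c' ` {s'..1}"
      proof
        assume "p \<in> pt n a' c' ` {s'..1}"
        then have "a' = a" "c' = c" "s' \<le> s"
          using p_eq[OF right(2)] by (auto simp: pt)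
        moreover from this have "s' = s"
          using right(4) s by linarith
        ultimately show False
          using \<open>z \<noteq> p\<close> right(1) pt by simp
      qed
      then show ?thesis
        unfolding right(1) using to_north_right[OF right(2-5)] by blast
    next
      case (arm a' c')
      have a': "a' \<in> P"
        using arm(2) A_subset by blast
      show ?thesis
      proof (cases "p \<in> (\<lambda>c. pt n a' c (1/2)) ` {c'..1/2} \<union> pt n a' (1/2) ` {1/2..1}")
        case True
        then have "a' = a" "s = 1/2" "c' \<le> c"
          using p_eq[OF a'] arm s by (auto simp: pt)
        then have "c' < c"
          using \<open>z \<noteq> p\<close> unfolding arm(1) pt \<open>a' = a\<close> \<open>s = 1/2\<close> by (cases "c = c'") auto
        then have "z \<in> M"
          using arm \<open>a' = a\<close> \<open>s = 1/2\<close> by (simp add: M_def)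
        then show ?thesis
          by blast
      next
        case False
        then show ?thesis
          unfolding arm(1) using to_north_arm[OF arm(2-4)] by blast
      qed
    qed
  qed
  then have "\<Union>{connected_component_set (X b - {p}) south,
      connected_component_set (X b - {p}) (north n), M} = X b - {p}"
    using sub connected_component_subset[of "X b - {p}" south]
      connected_component_subset[of "X b - {p}" "north n"]
    unfolding Union_insert Union_empty by blast
  then show ?thesis
    unfolding finitely_connected_def using conn
    by (intro exI[of _ "{connected_component_set (X b - {p}) south,
      connected_component_set (X b - {p}) (north n), M}"]) simp
qed

lemma finitely_connected_Diff:
  assumes p: "p \<in> X b" "p \<noteq> south" "p \<noteq> north n"
  shows "finitely_connected (X b - {p})"
proof (cases "p (Suc n) \<le> 1/2")
  case True
  then show ?thesis
    using p by (intro finitely_connected_Diff_left)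
next
  case False
  have p': "reflect n p \<in> X (\<not> b)"
    using p(1) homeomorphism_image1[OF homeomorphism_reflect[of b]] by blast
  have "reflect n p \<noteq> south"
    using p(3) by (metis reflect_poles(1) reflect_reflect)
  moreover have "reflect n p (Suc n) \<le> 1/2"
    using False by (simp add: reflect_def)
  ultimately have "finitely_connected (X (\<not> b) - {reflect n p})"
    by (rule finitely_connected_Diff_left[OF p'])
  then have "finitely_connected (reflect n ` (X (\<not> b) - {reflect n p}))"
    by (intro finitely_connected_continuous_image continuous_on_reflect)
  moreover have "reflect n ` (X (\<not> b) - {reflect n p}) = X b - {p}"
    using homeomorphism_image1[OF homeomorphism_Diff_singleton[OF homeomorphism_reflect p']]
    by simp
  ultimately show ?thesis
    by simp
qed

section \<open>Deletion of an apex\<close>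

definition blade :: "nat \<Rightarrow> (nat \<Rightarrow> real) set" where
  "blade k = {pt n a (slope k) s |a s. a \<in> P \<and> 0 < s \<and> s \<le> 1/2}"

lemma blade_subset_X: "even k = b \<Longrightarrow> blade k \<subseteq> X b"
  by (auto simp: blade_def slope_in_fan_slopes intro!: left_in_X)

text \<open>Without the apex, a blade is closed in the fan because its slope is fixed
  (\<open>C\<close>), and open because this slope is isolated among all that occur
  (\<open>U\<close>). A clopen set contains every connected subset that meets it.\<close>

lemma blade_absorbs_connected:
  assumes k: "even k = b" and M: "connected M" "M \<subseteq> X b - {south}" "M \<inter> blade k \<noteq> {}"
  shows "M \<subseteq> blade k"
proof -
  obtain l u where lu: "1/2 \<le> l" "l < slope k" "slope k < u"
    and iso: "\<And>j. l < slope j \<Longrightarrow> slope j < u \<Longrightarrow> j = k"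
    using slope_isolated[of k] by blast
  have cont: "continuous_on UNIV (\<lambda>x::nat \<Rightarrow> real. hgt (x (Suc n)))"
    unfolding hgt_def by (intro continuous_intros) auto
  \<comment> \<open>Slopes are compared after multiplication by \<open>hgt\<close>, which avoids
    dividing by 0. The north apex satisfies the equation as 0 = 0 and is excluded by the bound on
    the height; the strict inequalities of \<open>U\<close> exclude the apexes by
    themselves.\<close>
  define C where "C = {x. x n = hgt (x (Suc n)) * slope k \<and> x (Suc n) \<le> 1/2}"
  define U where "U = {x. hgt (x (Suc n)) * l < x n \<and> x n < hgt (x (Suc n)) * u}"
  have "closed C"
    unfolding C_def using cont
    by (intro closed_Collect_conj closed_Collect_eq closed_Collect_le continuous_intros) auto
  have "open U"
    unfolding U_def using cont
    by (intro open_Collect_conj open_Collect_less continuous_intros) auto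
  have U: "x \<in> U \<longleftrightarrow> x \<in> blade k" and C: "x \<in> C \<longleftrightarrow> x \<in> blade k" if x: "x \<in> X b - {south}" for x
  proof -
    have U': "hgt s > 0 \<and> l < c \<and> c < u" if "pt n a c s \<in> U" "0 \<le> s" "s \<le> 1" for a c s
    proof -
      have *: "hgt s * l < hgt s * c" "hgt s * c < hgt s * u"
        using that(1) by (simp_all add: U_def)
      then have "hgt s \<noteq> 0" "hgt s \<ge> 0"
        using hgt_bounds[OF that(2,3)] by auto
      then have "hgt s > 0"
        by simp
      then show ?thesis
        using * by (simp add: mult_less_cancel_left_pos)
    qed
    have b1: "pt n a (slope k) s \<in> U" "pt n a (slope k) s \<in> C" if "0 < s" "s \<le> 1/2" for a s
    proof -
      have "hgt s > 0"
        using that by (simp add: hgt_pos)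
      then show "pt n a (slope k) s \<in> U" "pt n a (slope k) s \<in> C"
        using that lu by (simp_all add: U_def C_def)
    qed
    have slope: "c = slope k" if c: "c \<in> fan_slopes d" "l < c" "c < u" for c d
      using c(1)
    proof (cases rule: fan_slopes_cases)
      case 1
      then show ?thesis using lu(1) c(2) by simp
    next
      case (2 j)
      then show ?thesis using iso[of j] c by simp
    qed
    have "x \<in> blade k" if "x \<in> U"
      using x[THEN DiffD1]
    proof (cases rule: in_X_cases)
      case (left a c s)
      have "hgt s > 0 \<and> l < c \<and> c < u"
        using U'[of a c s] that left by simp
      then have "0 < s" "c = slope k"
        using slope[OF left(3)] by (simp_all add: hgt_pos)
      then show ?thesis
        using left(1,2,5) unfolding blade_def by blast
    next
      \<comment> \<open>Contradictory: slopes with the parity of \<open>k\<close> do not occur on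
        the sheets of the north apex.\<close>
      case (right a c s)
      have "l < c \<and> c < u"
        using U'[of a c s] that right by simp
      then have "c = slope k"
        using slope[OF right(3)] by simp
      then show ?thesis
        using right(3) k by (simp add: slope_in_fan_slopes)
    next
      case (arm a c)
      have "l < c"
        using U'[of a c "1/2"] that arm(1) by simp
      then show ?thesis
        using lu(1) arm(4) by simp
    qed
    moreover have "x \<in> U" if "x \<in> C"
    proof -
      obtain a c s where x': "x = pt n a c s" "0 \<le> s"
        using in_X_params[OF x[THEN DiffD1]] by blast
      then have "s \<le> 1/2" "s \<noteq> 0"
        using that x by (auto simp: C_def)
      then have "hgt s > 0"
        using x'(2) by (simp add: hgt_pos)
      moreover from this have "c = slope k"
        using that x'(1) by (simp add: C_def)
      ultimately show ?thesis
        using lu by (simp add: U_def x'(1))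
    qed
    moreover have "x \<in> U" "x \<in> C" if "x \<in> blade k"
      using that b1 unfolding blade_def by blast+
    ultimately show "x \<in> U \<longleftrightarrow> x \<in> blade k" "x \<in> C \<longleftrightarrow> x \<in> blade k"
      by blast+
  qed
  have "M \<inter> U = M \<inter> blade k" "M \<inter> C = M \<inter> blade k"
    using U C M(2) by blast+
  then have "openin (top_of_set M) (M \<inter> blade k)" "closedin (top_of_set M) (M \<inter> blade k)"
    using openin_open_Int[OF \<open>open U\<close>, of M] closedin_closed_Int[OF \<open>closed C\<close>, of M] by simp_all
  then have "M \<inter> blade k = M"
    using M(1,3) unfolding connected_clopen by blast
  then show ?thesis
    by blast
qed

text \<open>A blade need not be connected, but a connected piece that meets it stays inside it.
  Disjoint blades thus require different pieces, and there are infinitely many blades.\<close>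

lemma not_finitely_connected_Diff_south: "\<not> finitely_connected (X b - {south})"
proof
  assume "finitely_connected (X b - {south})"
  then obtain \<M> where \<M>: "finite \<M>" "\<And>M. M \<in> \<M> \<Longrightarrow> connected M" "\<Union>\<M> = X b - {south}"
    by (auto simp: finitely_connected_def)
  obtain a where a: "a \<in> P"
    using A_nonempty A_subset by blast
  define x where "x k = pt n a (slope k) (1/2)" for k
  have x_blade: "x k \<in> blade j \<longleftrightarrow> j = k" for j k
  proof
    assume "x k \<in> blade j"
    then obtain a' s where "x k = pt n a' (slope j) s" "a' \<in> P"
      unfolding blade_def by blast
    then have "slope k = slope j"
      using inject[of a a' "1/2" "slope k" "slope j" s] a by (simp add: x_def)
    then show "j = k"
      using inj_slope by (simp add: inj_eq)
  next
    assume "j = k"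
    moreover have "(0::real) < 1/2" "(1/2::real) \<le> 1/2"
      by simp_all
    ultimately show "x k \<in> blade j"
      using a unfolding blade_def x_def by blast
  qed
  have "\<exists>M \<in> \<M>. x k \<in> M" if "even k = b" for k
  proof -
    have "x k \<in> X b - {south}"
      using blade_subset_X[OF that] x_blade[of k k] pt_eq_pole_iff[of n a "slope k" "1/2"]
      by (simp add: x_def subset_iff)
    then show ?thesis
      using \<M>(3) by blast
  qed
  then obtain F where F: "\<And>k. even k = b \<Longrightarrow> F k \<in> \<M> \<and> x k \<in> F k"
    by metis
  have "inj_on F {k. even k = b}"
  proof (rule inj_onI)
    fix j k assume jk: "j \<in> {k. even k = b}" "k \<in> {k. even k = b}" "F j = F k"
    then have Fj: "F j \<in> \<M>" "x j \<in> F j" "x k \<in> F j" and j: "even j = b"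
      using F[of j] F[of k] by simp_all
    have "F j \<subseteq> blade j"
    proof (rule blade_absorbs_connected[OF j])
      show "connected (F j)" "F j \<subseteq> X b - {south}"
        using \<M>(2)[OF Fj(1)] Fj(1) \<M>(3) by blast+
      show "F j \<inter> blade j \<noteq> {}"
        using Fj(2) x_blade[of j j] by blast
    qed
    then show "j = k"
      using Fj(3) x_blade[of k j] by blast
  qed
  moreover have "F ` {k. even k = b} \<subseteq> \<M>"
    using F by blast
  ultimately have "finite {k::nat. even k = b}"
    using \<M>(1) by (meson finite_imageD finite_subset)
  moreover have "{k::nat. even k = b} = range (\<lambda>j. 2 * j + of_bool (\<not> b))"
    by (cases b) (auto elim!: evenE oddE, presburger)
  ultimately show False
    by (simp add: finite_image_iff inj_def)
qed

lemma shattering_X: "shattering (X b) = {south, north n}"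
proof -
  have "reflect n ` shattering (X (\<not> b)) = shattering (X b)"
    using homeomorphism_image_shattering[OF homeomorphism_reflect[of "\<not> b"]] by simp
  moreover have south: "south \<in> shattering (X b)" for b
    using not_finitely_connected_Diff_south by (simp add: shattering_def)
  ultimately have "north n \<in> shattering (X b)"
    using imageI[OF south[of "\<not> b"], of "reflect n"] by simp
  moreover have "p = south \<or> p = north n" if "p \<in> shattering (X b)" for p
    using finitely_connected_Diff[of p b] that by (auto simp: shattering_def)
  ultimately show ?thesis
    using south by blast
qed

text \<open>The component of the north apex is everything off the blades: a blade that met it would
  contain it, apex included. So the blades are what is cut off, and their closure adds the south
  apex and the sheet of the limit slope 1/2.\<close>

lemma branch_closure_south:
  "branch_closure (X b) south (north n) =
    (\<lambda>(a, c, s). pt n a c s) ` (P \<times> fan_slopes b \<times> {0..1/2})"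
proof -
  let ?B = "\<Union>k\<in>{k. even k = b}. blade k"
  let ?K = "connected_component_set (X b - {south}) (north n)"
  have "?K \<inter> blade k = {}" if k: "even k = b" for k
  proof (rule ccontr)
    assume "?K \<inter> blade k \<noteq> {}"
    then have "?K \<subseteq> blade k"
      by (rule blade_absorbs_connected[OF k connected_connected_component connected_component_subset])
    moreover have "north n \<in> ?K"
      by simp
    moreover have "north n \<notin> blade k"
      by (auto simp: blade_def pt_eq_pole_iff eq_commute[of "north n"])
    ultimately show False
      by blast
  qed
  then have disj: "?K \<inter> ?B = {}"
    by blast
  have sub: "?B \<subseteq> X b - {south}"
  proof -
    have "south \<notin> blade k" for k
      by (auto simp: blade_def pt_eq_pole_iff eq_commute[of south])
    then show ?thesis
      using blade_subset_X by blast
  qed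
  have "X b - {south} - ?B \<subseteq> ?K"
  proof
    fix z assume z: "z \<in> X b - {south} - ?B"
    then have "z \<in> X b"
      by blast
    then show "z \<in> ?K"
    proof (cases rule: in_X_cases)
      case (left a c s)
      have s: "0 < s"
        using z left by (cases "s = 0") auto
      have "c = 1/2"
        using left(3)
      proof (cases rule: fan_slopes_cases)
        case (2 k)
        then have "z \<in> blade k"
          using left s by (auto simp: blade_def)
        then show ?thesis
          using z 2 by auto
      qed
      then show ?thesis
        unfolding left(1) \<open>c = 1/2\<close> using left s
        by (intro to_north_base) (auto simp: pt_eq_pole_iff eq_commute[of south])
    next
      case (right a c s)
      then show ?thesis
        unfolding right(1)
        by (intro to_north_right) (auto simp: pt_eq_pole_iff eq_commute[of south])
    next
      case (arm a c)
      then show ?thesis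
        unfolding arm(1)
        by (intro to_north_arm) (auto simp: pt_eq_pole_iff eq_commute[of south])
    qed
  qed
  then have "X b - {south} - ?K = ?B"
    using disj sub by blast
  also have "?B = (\<lambda>(a, c, s). pt n a c s) ` (P \<times> slope ` {k. even k = b} \<times> {0<..1/2})"
    by (force simp: blade_def)
  finally have eq: "branch_closure (X b) south (north n) =
      closure ((\<lambda>(a, c, s). pt n a c s) ` (P \<times> slope ` {k. even k = b} \<times> {0<..1/2}))"
    by (simp add: branch_closure_def)
  \<comment> \<open>In the parameter space the closure is a product. Compactness of the larger set
    gives one inclusion between the images, continuity the other.\<close>
  have cl: "closure (P \<times> slope ` {k. even k = b} \<times> {0<..1/2::real}) = P \<times> fan_slopes b \<times> {0..1/2}"
    using compact_P by (simp add: closure_Times closure_slopes compact_imp_closed)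
  show ?thesis
  proof
    have "compact ((\<lambda>(a, c, s). pt n a c s) ` (P \<times> fan_slopes b \<times> {0..1/2}))"
      by (intro compact_continuous_image continuous_on_pt_params compact_Times compact_P
          compact_fan_slopes compact_Icc)
    then show "branch_closure (X b) south (north n) \<subseteq>
        (\<lambda>(a, c, s). pt n a c s) ` (P \<times> fan_slopes b \<times> {0..1/2})"
      unfolding eq
      by (intro closure_minimal image_mono Sigma_mono compact_imp_closed) (auto simp: fan_slopes_def)
    show "(\<lambda>(a, c, s). pt n a c s) ` (P \<times> fan_slopes b \<times> {0..1/2}) \<subseteq>
        branch_closure (X b) south (north n)"
      unfolding eq cl[symmetric]
      by (intro image_closure_subset continuous_on_pt_params closed_closure closure_subset)
  qed
qed

lemma branch_closure_north:
  "branch_closure (X b) (north n) south =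
    (\<lambda>(a, c, s). pt n a c s) ` (P \<times> fan_slopes (\<not> b) \<times> {1/2..1})"
proof -
  have "branch_closure (X b) (north n) south = reflect n ` branch_closure (X (\<not> b)) south (north n)"
    using homeomorphism_image_branch_closure[OF homeomorphism_reflect[of "\<not> b"] compact_X, of south "north n"]
    by simp
  also have "\<dots> = (\<lambda>(a, c, s). pt n a c (1 - s)) ` (P \<times> fan_slopes (\<not> b) \<times> {0..1/2})"
    by (simp add: branch_closure_south image_image case_prod_beta reflect_pt)
  also have "\<dots> = (\<lambda>(a, c, s). pt n a c s) ` (P \<times> fan_slopes (\<not> b) \<times> {1/2..1})"
    (is "?l = ?r")
  proof
    show "?l \<subseteq> ?r"
      by force
    show "?r \<subseteq> ?l"
    proof clarify
      fix a c and s :: real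
      assume "a \<in> P" "c \<in> fan_slopes (\<not> b)" "s \<in> {1/2..1}"
      then show "pt n a c s \<in> ?l"
        by (intro image_eqI[of _ _ "(a, c, 1 - s)"]) auto
    qed
  qed
  finally show ?thesis .
qed

text \<open>The two closures can meet only at height 1/2, and the only slope common to both parities
  is 1/2.\<close>

lemma spine_X: "spine (X b) south (north n) = (\<lambda>a. pt n a (1/2) (1/2)) ` P"
proof
  show "spine (X b) south (north n) \<subseteq> (\<lambda>a. pt n a (1/2) (1/2)) ` P"
  proof
    fix x assume "x \<in> spine (X b) south (north n)"
    then have x': "x \<in> (\<lambda>(a, c, s). pt n a c s) ` (P \<times> fan_slopes b \<times> {0..1/2})"
        "x \<in> (\<lambda>(a, c, s). pt n a c s) ` (P \<times> fan_slopes (\<not> b) \<times> {1/2..1})"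
      unfolding spine_def branch_closure_south branch_closure_north by auto
    from x'(1) obtain a c s where 1: "x = pt n a c s" "a \<in> P" "c \<in> fan_slopes b" "s \<le> 1/2"
      by auto
    from x'(2) obtain a' c' s'
      where 2: "x = pt n a' c' s'" "a' \<in> P" "c' \<in> fan_slopes (\<not> b)" "1/2 \<le> s'"
      by auto
    note x = 1(1) 2(1) and in' = 1(2-4) 2(2-4)
    have "s = s'"
      using x by (metis pt_simps(3))
    then have s: "s = 1/2" "s' = 1/2"
      using in' by auto
    then have "c = c'"
      using inject[of a a' s c c' s'] in' x by auto
    have "c = 1/2"
      using in'(2)
    proof (cases rule: fan_slopes_cases)
      case (2 k)
      then show ?thesis
        using in'(5) \<open>c = c'\<close> by (simp add: slope_in_fan_slopes)
    qed
    then show "x \<in> (\<lambda>a. pt n a (1/2) (1/2)) ` P"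
      using x(1) s in'(1) by blast
  qed
  show "(\<lambda>a. pt n a (1/2) (1/2)) ` P \<subseteq> spine (X b) south (north n)"
  proof (rule image_subsetI)
    fix a assume "a \<in> P"
    then show "pt n a (1/2) (1/2) \<in> spine (X b) south (north n)"
      unfolding spine_def branch_closure_south branch_closure_north
      by (intro IntI image_eqI[of _ _ "(a, 1/2, 1/2)"]) auto
  qed
qed

text \<open>Slopes of sheets are at least 1/2, so outside both closures there remains the arm with
  \<open>c < 1/2\<close>; its closure adds the end \<open>c = 1/2\<close> on the equator.\<close>

lemma marked_spine_X: "marked_spine (X b) south (north n) = (\<lambda>a. pt n a (1/2) (1/2)) ` A"
proof -
  let ?arm = "\<lambda>I. (\<lambda>(a, c). pt n a c (1/2)) ` (A \<times> I)"
  have cont: "continuous_on S (\<lambda>(a, c). pt n a c (1/2))" for S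
    unfolding case_prod_beta by (intro continuous_intros)
  have "X b - branch_closure (X b) south (north n) - branch_closure (X b) (north n) south = ?arm {0..<1/2}"
  proof
    show "X b - branch_closure (X b) south (north n) - branch_closure (X b) (north n) south \<subseteq> ?arm {0..<1/2}"
    proof
      fix x
      assume x: "x \<in> X b - branch_closure (X b) south (north n) - branch_closure (X b) (north n) south"
      then have "x \<in> X b"
        by blast
      then show "x \<in> ?arm {0..<1/2}"
      proof (cases rule: in_X_cases)
        case (left a c s)
        then have "x \<in> branch_closure (X b) south (north n)"
          unfolding branch_closure_south by (intro image_eqI[of _ _ "(a, c, s)"]) auto
        then show ?thesis
          using x by blast
      next
        case (right a c s)
        then have "x \<in> branch_closure (X b) (north n) south"
          unfolding branch_closure_north by (intro image_eqI[of _ _ "(a, c, s)"]) auto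
        then show ?thesis
          using x by blast
      next
        case (arm a c)
        have "c \<noteq> 1/2"
        proof
          assume "c = 1/2"
          then have "x \<in> spine (X b) south (north n)"
            using arm(2) A_subset unfolding spine_X arm(1) \<open>c = 1/2\<close> by blast
          then show False
            using x by (auto simp: spine_def)
        qed
        then show ?thesis
          using arm by (intro image_eqI[of _ _ "(a, c)"]) auto
      qed
    qed
    show "?arm {0..<1/2} \<subseteq> X b - branch_closure (X b) south (north n) - branch_closure (X b) (north n) south"
    proof clarify
      fix a c assume ac: "a \<in> A" "c \<in> {0..<1/2::real}"
      have no: "pt n a c (1/2) \<noteq> pt n a' c' s'" if "a' \<in> P" "c' \<in> fan_slopes d" for a' c' s' d
        using inject[of a a' "1/2" c c' s'] ac that A_subset fan_slopes_bounds[of c' d] by auto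
      show "pt n a c (1/2) \<in> X b - branch_closure (X b) south (north n) - branch_closure (X b) (north n) south"
        unfolding branch_closure_south branch_closure_north using no ac
        by (auto intro!: arm_in_X)
    qed
  qed
  moreover have "closure (?arm {0..<1/2}) = ?arm {0..1/2}"
  proof -
    have cl: "closure (A \<times> {0..<1/2::real}) = A \<times> {0..1/2}"
      using compact_A by (simp add: closure_Times compact_imp_closed)
    show ?thesis
    proof
      have "compact (?arm {0..1/2})"
        by (intro compact_continuous_image cont compact_Times compact_A compact_Icc)
      then show "closure (?arm {0..<1/2}) \<subseteq> ?arm {0..1/2}"
        by (intro closure_minimal image_mono) (auto intro: compact_imp_closed)
      show "?arm {0..1/2} \<subseteq> closure (?arm {0..<1/2})"
        unfolding cl[symmetric]
        by (intro image_closure_subset cont closed_closure closure_subset)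
    qed
  qed
  ultimately have "marked_spine (X b) south (north n) = (\<lambda>a. pt n a (1/2) (1/2)) ` P \<inter> ?arm {0..1/2}"
    by (simp add: marked_spine_def spine_X)
  also have "\<dots> = (\<lambda>a. pt n a (1/2) (1/2)) ` A"
  proof
    show "(\<lambda>a. pt n a (1/2) (1/2)) ` P \<inter> ?arm {0..1/2} \<subseteq> (\<lambda>a. pt n a (1/2) (1/2)) ` A"
    proof clarify
      fix a a' c assume "a \<in> P" "a' \<in> A" "pt n a (1/2) (1/2) = pt n a' c (1/2)"
      moreover have "a = a'"
        using calculation inject[of a a' "1/2" "1/2" c "1/2"] A_subset by auto
      ultimately show "pt n a (1/2) (1/2) \<in> (\<lambda>a. pt n a (1/2) (1/2)) ` A"
        by blast
    qed
    show "(\<lambda>a. pt n a (1/2) (1/2)) ` A \<subseteq> (\<lambda>a. pt n a (1/2) (1/2)) ` P \<inter> ?arm {0..1/2}"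
      using A_subset by force
  qed
  finally show ?thesis .
qed

end

section \<open>Reduction to homeomorphism of continua\<close>

lemma homeomorphism_image_spine:
  fixes X :: "'a::t2_space set" and Y :: "'b::t2_space set"
  assumes gh: "homeomorphism X Y g h" and "compact X" and pq: "p \<in> X" "q \<in> X" "p \<noteq> q"
  shows "g ` spine X p q = spine Y (g p) (g q)"
    and "g ` marked_spine X p q = marked_spine Y (g p) (g q)"
proof -
  have inj: "inj_on g X" and gX: "g ` X = Y"
    using gh inj_on_inverseI[of X h g] by (simp_all add: homeomorphism_def)
  have "closed X"
    using \<open>compact X\<close> by (rule compact_imp_closed)
  have sub: "branch_closure X p q \<subseteq> X" for p q
    unfolding branch_closure_def by (rule closure_minimal[OF _ \<open>closed X\<close>]) blast
  have bc: "g ` branch_closure X p q = branch_closure Y (g p) (g q)"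
      "g ` branch_closure X q p = branch_closure Y (g q) (g p)"
    using homeomorphism_image_branch_closure[OF gh \<open>compact X\<close>] pq by simp_all
  show spine: "g ` spine X p q = spine Y (g p) (g q)"
    unfolding spine_def inj_on_image_Int[OF inj sub sub] bc ..
  define R where "R = X - branch_closure X p q - branch_closure X q p"
  have R: "R \<subseteq> X"
    by (auto simp: R_def)
  then have clR: "closure R \<subseteq> X"
    using closure_minimal \<open>closed X\<close> by blast
  have diff: "g ` (S - T) = g ` S - g ` T" if "S \<subseteq> X" "T \<subseteq> X" for S T
    by (rule inj_on_image_set_diff[OF inj]) (use that in blast)+
  have gR: "g ` R = Y - branch_closure Y (g p) (g q) - branch_closure Y (g q) (g p)"
    unfolding R_def using diff[OF _ sub, of "X - branch_closure X p q" q p] diff[OF subset_refl sub, of p q]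
    by (simp only: bc gX Diff_subset)
  have spine_sub: "spine X p q \<subseteq> X"
    using sub unfolding spine_def by blast
  have "g ` marked_spine X p q = g ` spine X p q \<inter> g ` closure R"
    unfolding marked_spine_def R_def[symmetric] by (rule inj_on_image_Int[OF inj spine_sub clR])
  then show "g ` marked_spine X p q = marked_spine Y (g p) (g q)"
    unfolding spine homeomorphism_image_closure[OF gh \<open>compact X\<close> R] gR marked_spine_def .
qed

definition unpt :: "nat \<Rightarrow> (nat \<Rightarrow> real) \<Rightarrow> nat \<Rightarrow> real" where
  "unpt n x = (\<lambda>i. if i < n then x i / hgt (x (Suc n)) else 0)"

lemma unpt_pt:
  assumes "a \<in> topspace (cube n)" "0 < s" "s < 1"
  shows "unpt n (pt n a c s) = a"
proof -
  have "hgt s > 0"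
    using assms by (simp add: hgt_pos)
  then show ?thesis
    using assms by (auto simp: unpt_def topspace_cube)
qed

lemma (in cube_pair) homeomorphism_midpoint:
  assumes "S \<subseteq> P"
  shows "homeomorphism S ((\<lambda>a. pt n a (1/2) (1/2)) ` S) (\<lambda>a. pt n a (1/2) (1/2)) (unpt n)"
proof -
  have unpt: "unpt n (pt n a (1/2) (1/2)) = a" if "a \<in> S" for a
    using assms P_subset that by (intro unpt_pt) auto
  \<comment> \<open>Since \<open>hgt (1/2) = 1/2\<close>, on the equator \<open>unpt\<close> is
    doubling of the first \<open>n\<close> coordinates, which is continuous everywhere.\<close>
  have "continuous_on T (\<lambda>x. if i < n then 2 * x i else (0::real))" for T :: "(nat \<Rightarrow> real) set" and i
    by (cases "i < n")
      (auto intro!: continuous_intros continuous_on_product_then_coordinatewise[where f="\<lambda>x. x"])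
  then have "continuous_on T (\<lambda>x i. if i < n then 2 * x i else (0::real))"
    for T :: "(nat \<Rightarrow> real) set"
    by (rule continuous_on_coordinatewise_then_product)
  moreover have "unpt n x = (\<lambda>i. if i < n then 2 * x i else 0)"
    if "x \<in> (\<lambda>a. pt n a (1/2) (1/2)) ` S" for x
    using that by (auto simp: unpt_def)
  ultimately have "continuous_on ((\<lambda>a. pt n a (1/2) (1/2)) ` S) (unpt n)"
    by (metis (no_types, lifting) continuous_on_cong)
  then show ?thesis
    using unpt by (intro homeomorphismI continuous_on_pt continuous_on_id continuous_on_const) auto
qed

text \<open>The homeomorphism preserves the pair of shattering points, hence the equator and its
  marked part. Conjugating its restriction with the identification \<open>?j\<close> of
  \<open>P\<close> and the equator gives the map of pairs.\<close>

lemma pair_homeomorphism_if_double_fan_homeomorphic: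
  assumes "cube_pair n P A" "cube_pair n P' A'"
    and "double_fan n True P A homeomorphic double_fan n True P' A'"
  shows "\<exists>h k. homeomorphism P P' h k \<and> h ` A = A'"
proof -
  interpret X: cube_pair n P A by fact
  interpret Y: cube_pair n P' A' by fact
  let ?j = "\<lambda>a. pt n a (1/2) (1/2)"
  obtain g k where gk: "homeomorphism (X.X True) (Y.X True) g k"
    using assms(3) unfolding homeomorphic_def by blast
  have inj: "g south \<noteq> g (north n)"
    using gk X.poles_in_X[of True] north_neq_south(2)[of n] unfolding homeomorphism_def by metis
  have "g ` {south, north n} = {south, north n}"
    using homeomorphism_image_shattering[OF gk] unfolding X.shattering_X Y.shattering_X .
  then have "{g south, g (north n)} = {south, north n}"
    by simp
  then consider "g south = south" "g (north n) = north n" | "g south = north n" "g (north n) = south"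
    unfolding doubleton_eq_iff by blast
  then have "g ` spine (X.X True) south (north n) = spine (Y.X True) south (north n) \<and>
    g ` marked_spine (X.X True) south (north n) = marked_spine (Y.X True) south (north n)"
  proof cases
    case 1
    then show ?thesis
      using homeomorphism_image_spine[OF gk X.compact_X X.poles_in_X(1) X.poles_in_X(2), OF north_neq_south(2)]
      by simp
  next
    case 2
    then show ?thesis
      using homeomorphism_image_spine[OF gk X.compact_X X.poles_in_X(1) X.poles_in_X(2), OF north_neq_south(2)]
      by (simp add: spine_commute[of _ "north n"] marked_spine_commute[of _ "north n"])
  qed
  then have gP: "g ` ?j ` P = ?j ` P'" and gA: "g ` ?j ` A = ?j ` A'"
    unfolding X.spine_X X.marked_spine_X Y.spine_X Y.marked_spine_X by blast+
  have "?j ` P \<subseteq> X.X True" "?j ` P' \<subseteq> Y.X True"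
    by (auto intro: X.base_in_X Y.base_in_X)
  then have "homeomorphism (?j ` P) (?j ` P') g k"
    using gP by (rule homeomorphism_of_subsets[OF gk])
  then have "homeomorphism P (?j ` P') (g \<circ> ?j) (unpt n \<circ> k)"
    by (rule homeomorphism_compose[OF X.homeomorphism_midpoint[OF subset_refl]])
  then have "homeomorphism P P' (unpt n \<circ> (g \<circ> ?j)) ((unpt n \<circ> k) \<circ> ?j)"
    by (rule homeomorphism_compose[OF _ homeomorphism_symD[OF Y.homeomorphism_midpoint[OF subset_refl]]])
  moreover have "(unpt n \<circ> (g \<circ> ?j)) ` A = unpt n ` (g ` ?j ` A)"
    by (simp add: image_image)
  moreover have "unpt n ` ?j ` A' = A'"
    using Y.homeomorphism_midpoint[OF Y.A_subset] by (simp add: homeomorphism_def)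
  ultimately show ?thesis
    unfolding gA by metis
qed

text \<open>A continuous map from a compact space to a Hausdorff space is closed, hence a quotient
  map onto its image.\<close>

lemma continuous_on_compact_quotient:
  fixes f :: "'a::topological_space \<Rightarrow> 'b::t2_space" and G :: "'b \<Rightarrow> 'c::topological_space"
  assumes "compact K" "continuous_on K f" "continuous_on K (\<lambda>t. G (f t))"
  shows "continuous_on (f ` K) G"
  unfolding continuous_closedin_preimage_eq
proof (intro allI impI)
  fix T :: "'c set" assume "closed T"
  then have "closedin (top_of_set K) (K \<inter> (\<lambda>t. G (f t)) -` T)"
    by (intro continuous_closedin_preimage assms)
  then have "compact (K \<inter> (\<lambda>t. G (f t)) -` T)"
    by (rule closedin_compact[OF \<open>compact K\<close>])
  then have "compact (f ` (K \<inter> (\<lambda>t. G (f t)) -` T))"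
    by (intro compact_continuous_image continuous_on_subset[OF assms(2)]) auto
  moreover have "f ` (K \<inter> (\<lambda>t. G (f t)) -` T) = f ` K \<inter> G -` T"
    by auto
  ultimately have "closed (f ` K \<inter> G -` T)"
    by (simp add: compact_imp_closed)
  then show "closedin (top_of_set (f ` K)) (f ` K \<inter> G -` T)"
    by (intro closed_subset) auto
qed

text \<open>At the poles the height vanishes, so the junk values of the divisions there are multiplied
  by \<open>0\<close> and the map fixes both poles.\<close>

definition fan_map ::
    "nat \<Rightarrow> ((nat \<Rightarrow> real) \<Rightarrow> nat \<Rightarrow> real) \<Rightarrow> (nat \<Rightarrow> real) \<Rightarrow> nat \<Rightarrow> real" where
  "fan_map n h x = pt n (h (unpt n x)) (x n / hgt (x (Suc n))) (x (Suc n))"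

lemma fan_map_pt:
  assumes "a \<in> topspace (cube n)" "0 \<le> s" "s \<le> 1"
  shows "fan_map n h (pt n a c s) = pt n (h a) c s"
proof -
  consider "s = 0" | "s = 1" | "0 < s" "s < 1"
    using assms by linarith
  then show ?thesis
  proof cases
    case 1
    then show ?thesis by (simp add: fan_map_def south_def)
  next
    case 2
    then show ?thesis by (simp add: fan_map_def north_def)
  next
    case 3
    moreover from this have "hgt s > 0"
      by (simp add: hgt_pos)
    ultimately show ?thesis
      using unpt_pt[OF assms(1), of s c] by (simp add: fan_map_def)
  qed
qed

text \<open>At the apexes the formula with divisions does not show continuity. On the compact
  parameter space the map becomes \<open>(a, c, s) \<mapsto> (h a, c, s)\<close>, and continuity
  descends along the quotient map \<open>pt\<close>.\<close>

lemma fan_map_double_fan: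
  assumes X: "cube_pair n P A" and Y: "cube_pair n P' A'"
    and h: "continuous_on P h" "h ` P \<subseteq> P'" "h ` A \<subseteq> A'"
  shows "continuous_on (double_fan n b P A) (fan_map n h)"
    and "fan_map n h ` double_fan n b P A \<subseteq> double_fan n b P' A'"
proof -
  interpret X: cube_pair n P A by fact
  interpret Y: cube_pair n P' A' by fact
  have params: "a \<in> P \<and> 0 \<le> s \<and> s \<le> 1 \<and> (h a, c, s) \<in> params b P' A'"
    if "(a, c, s) \<in> params b P A" for a c s
    using that h(2,3) X.A_subset by (auto simp: params_def)
  have eq: "fan_map n h (pt n a c s) = pt n (h a) c s" if "(a, c, s) \<in> params b P A" for a c s
    using params[OF that] X.P_subset by (intro fan_map_pt) auto
  have "continuous_on (params b P A) (\<lambda>t. h (fst t))"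
    using params by (intro continuous_on_compose2[OF h(1)] continuous_intros) auto
  then have "continuous_on (params b P A) (\<lambda>t. pt n (h (fst t)) (fst (snd t)) (snd (snd t)))"
    by (rule continuous_on_pt) (intro continuous_on_fst continuous_on_snd continuous_on_id)+
  then have "continuous_on (params b P A) (\<lambda>t. fan_map n h ((\<lambda>(a, c, s). pt n a c s) t))"
    by (rule continuous_on_cong[THEN iffD1, rotated -1]) (use eq in auto)
  then show "continuous_on (double_fan n b P A) (fan_map n h)"
    unfolding double_fan_def
    by (rule continuous_on_compact_quotient[OF X.compact_params X.continuous_on_pt_params])
  show "fan_map n h ` double_fan n b P A \<subseteq> double_fan n b P' A'"
  proof (rule image_subsetI)
    fix x assume "x \<in> double_fan n b P A"
    then obtain a c s where "x = pt n a c s" "(a, c, s) \<in> params b P A"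
      by (auto simp: double_fan_def)
    then show "fan_map n h x \<in> double_fan n b P' A'"
      unfolding double_fan_def using eq params by (intro image_eqI[of _ _ "(h a, c, s)"]) auto
  qed
qed

lemma fan_map_inverse:
  assumes X: "cube_pair n P A" and Y: "cube_pair n P' A'"
    and h: "h ` P \<subseteq> P'" "\<And>a. a \<in> P \<Longrightarrow> k (h a) = a" and x: "x \<in> double_fan n b P A"
  shows "fan_map n k (fan_map n h x) = x"
proof -
  interpret X: cube_pair n P A by fact
  interpret Y: cube_pair n P' A' by fact
  obtain a c s where x: "x = pt n a c s" "(a, c, s) \<in> params b P A"
    using x by (auto simp: double_fan_def)
  then have a: "a \<in> P" "0 \<le> s" "s \<le> 1"
    using X.A_subset by (auto simp: params_def)
  then have "a \<in> topspace (cube n)" "h a \<in> topspace (cube n)"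
    using h(1) X.P_subset Y.P_subset by blast+
  then show ?thesis
    using a h(2) by (simp add: x(1) fan_map_pt)
qed

lemma double_fan_homeomorphic_if_pair_homeomorphism:
  assumes X: "cube_pair n P A" and Y: "cube_pair n P' A'"
    and hk: "homeomorphism P P' h k" and A': "h ` A = A'"
  shows "double_fan n b P A homeomorphic double_fan n b P' A'"
proof -
  have h: "continuous_on P h" "h ` P \<subseteq> P'" "h ` A \<subseteq> A'" "\<And>a. a \<in> P \<Longrightarrow> k (h a) = a"
    and k: "continuous_on P' k" "k ` P' \<subseteq> P" "\<And>a. a \<in> P' \<Longrightarrow> h (k a) = a"
    using hk A' by (simp_all add: homeomorphism_def)
  have kA: "k ` A' \<subseteq> A"
    using h(4) cube_pair.A_subset[OF X] unfolding A'[symmetric] by force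
  have "homeomorphism (double_fan n b P A) (double_fan n b P' A') (fan_map n h) (fan_map n k)"
    by (intro homeomorphismI fan_map_double_fan[OF X Y h(1-3)] fan_map_double_fan[OF Y X k(1,2) kA]
        fan_map_inverse[OF X Y h(2,4)] fan_map_inverse[OF Y X k(2,3)])
  then show ?thesis
    by (auto simp: homeomorphic_def)
qed

lemma double_fan_homeomorphic_iff:
  assumes "cube_pair n P A" "cube_pair n P' A'"
  shows "double_fan n True P A homeomorphic double_fan n True P' A' \<longleftrightarrow>
    (\<exists>h k. homeomorphism P P' h k \<and> h ` A = A')"
  using pair_homeomorphism_if_double_fan_homeomorphic[OF assms]
    double_fan_homeomorphic_if_pair_homeomorphism[OF assms] by blast

lemma (in cube_pair) double_fan_in_continua: "X b \<in> space (continua (cube (n + 2)))"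
  using compact_X connected_X X_subset_cube poles_in_X(1) unfolding space_continua_cube by blast

section \<open>Borel measurability of the double fan, and parts (1) and (2)\<close>

lemma measurable_continua_if_effros:
  assumes f: "f \<in> measurable M (effros X)" and "\<And>x. x \<in> space M \<Longrightarrow> f x \<in> space (continua X)"
  shows "f \<in> measurable M (continua X)"
  unfolding continua_def using assms(2)
  by (intro measurable_restrict_space2[OF _ f]) (auto simp: continua_def space_restrict_space)

lemma measurable_continua_union_images:
  assumes cont: "\<And>A. A \<in> space (effros (cube n)) \<Longrightarrow> \<Phi> A \<in> space (continua (cube m))"
    and \<Phi>: "\<And>A. \<Phi> A = K \<union> (\<Union>t\<in>T. f t ` A)"
    and f: "\<And>t. t \<in> T \<Longrightarrow> continuous_on (topspace (cube n)) (f t)"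
      "\<And>t. t \<in> T \<Longrightarrow> f t ` topspace (cube n) \<subseteq> topspace (cube m)"
  shows "\<Phi> \<in> measurable (effros (cube n)) (continua (cube m))"
proof (rule measurable_continua_if_effros[OF _ cont])
  have "K \<union> (\<Union>t\<in>T. f t ` A) \<in> space (effros (cube m))" if "A \<in> space (effros (cube n))" for A
    using cont[OF that] unfolding \<Phi> space_continua_cube space_effros_cube by blast
  then have "(\<lambda>A. K \<union> (\<Union>t\<in>T. f t ` A)) \<in> measurable (effros (cube n)) (effros (cube m))"
    using f measurable_effros_union_images[of "topspace (cube n)" K f T "topspace (cube m)"]
    unfolding cube_eq_top_of_set[symmetric] by blast
  then show "\<Phi> \<in> measurable (effros (cube n)) (effros (cube m))"
    unfolding \<Phi>[abs_def] .
qed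

definition fan_shape :: "bool \<Rightarrow> (real \<times> real) set" where
  "fan_shape b = fan_slopes b \<times> {0..1/2} \<union> fan_slopes (\<not> b) \<times> {1/2..1}"

definition arm_shape :: "(real \<times> real) set" where
  "arm_shape = {0..1/2} \<times> {1/2}"

text \<open>The form that the measurability lemma expects: each \<open>(c, s)\<close> gives one
  continuous map. In (1) both unions are images of \<open>A\<close> and \<open>K\<close> is empty;
  in (2) the first union is the constant \<open>K\<close>.\<close>

lemma double_fan_eq_union_images:
  "double_fan n b P A = (\<Union>t\<in>fan_shape b. (\<lambda>a. pt n a (fst t) (snd t)) ` P) \<union>
    (\<Union>t\<in>arm_shape. (\<lambda>a. pt n a (fst t) (snd t)) ` A)"
proof -
  have "params b P A = P \<times> fan_shape b \<union> A \<times> arm_shape"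
    by (auto simp: params_def fan_shape_def arm_shape_def)
  moreover have "(\<lambda>(a, c, s). pt n a c s) ` (B \<times> T) = (\<Union>t\<in>T. (\<lambda>a. pt n a (fst t) (snd t)) ` B)"
    for B and T :: "(real \<times> real) set"
    by force
  ultimately show ?thesis
    by (simp add: double_fan_def image_Un)
qed

lemma shape_bounds: "t \<in> fan_shape b \<union> arm_shape \<Longrightarrow> 0 \<le> fst t \<and> fst t \<le> 1 \<and> 0 \<le> snd t \<and> snd t \<le> 1"
  by (auto simp: fan_shape_def arm_shape_def dest!: fan_slopes_bounds)

lemma pt_image_cube:
  "t \<in> fan_shape b \<union> arm_shape \<Longrightarrow>
    (\<lambda>a. pt n a (fst t) (snd t)) ` topspace (cube n) \<subseteq> topspace (cube (n + 2))"
  using shape_bounds[of t b] by (intro image_subsetI pt_in_cube) auto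

theorem H_rel_reducible_C_rel:
  "borel_reducible (effros (cube n)) (H_rel n) (continua (cube (n + 2))) (C_rel (n + 2))"
  unfolding borel_reducible_def
proof (intro bexI ballI)
  let ?\<Phi> = "\<lambda>A. double_fan n True A A"
  have pair: "cube_pair n A A" if "A \<in> space (effros (cube n))" for A
    using that by (simp add: cube_pair_def space_effros_cube)
  show "?\<Phi> \<in> measurable (effros (cube n)) (continua (cube (n + 2)))"
  proof (rule measurable_continua_union_images)
    show "?\<Phi> A = {} \<union> (\<Union>t\<in>fan_shape True \<union> arm_shape. (\<lambda>a. pt n a (fst t) (snd t)) ` A)" for A
      by (simp add: double_fan_eq_union_images UN_Un)
  qed (use cube_pair.double_fan_in_continua[OF pair] pt_image_cube in \<open>auto intro!: continuous_on_pt continuous_on_id continuous_on_const\<close>)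
  fix A B assume AB: "A \<in> space (effros (cube n))" "B \<in> space (effros (cube n))"
  \<comment> \<open>With \<open>P = A\<close> the condition on the marked set holds for every
    homeomorphism.\<close>
  have "(\<exists>h k. homeomorphism A B h k \<and> h ` A = B) \<longleftrightarrow> A homeomorphic B"
    by (auto simp: homeomorphic_def homeomorphism_def)
  then show "(A, B) \<in> H_rel n \<longleftrightarrow> (?\<Phi> A, ?\<Phi> B) \<in> C_rel (n + 2)"
    using AB cube_pair.double_fan_in_continua[OF pair]
    by (simp add: H_rel_iff C_rel_iff double_fan_homeomorphic_iff[OF pair pair])
qed

theorem R_rel_reducible_C_rel:
  "borel_reducible (effros (cube n)) (R_rel n) (continua (cube (n + 2))) (C_rel (n + 2))"
  unfolding borel_reducible_def
proof (intro bexI ballI)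
  let ?Q = "topspace (cube n)"
  let ?\<Phi> = "\<lambda>A. double_fan n True ?Q A"
  have pair: "cube_pair n ?Q A" if "A \<in> space (effros (cube n))" for A
    using that by (simp add: cube_pair_def space_effros_cube compact_topspace_cube)
  show "?\<Phi> \<in> measurable (effros (cube n)) (continua (cube (n + 2)))"
  proof (rule measurable_continua_union_images[OF _ double_fan_eq_union_images])
  qed (use cube_pair.double_fan_in_continua[OF pair] pt_image_cube in \<open>auto intro!: continuous_on_pt continuous_on_id continuous_on_const\<close>)
  fix A B assume AB: "A \<in> space (effros (cube n))" "B \<in> space (effros (cube n))"
  then show "(A, B) \<in> R_rel n \<longleftrightarrow> (?\<Phi> A, ?\<Phi> B) \<in> C_rel (n + 2)"
    using cube_pair.double_fan_in_continua[OF pair]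
    by (simp add: R_rel_iff_homeomorphism C_rel_iff double_fan_homeomorphic_iff[OF pair pair])
qed

section \<open>Raising the dimension of the ambient cube\<close>

text \<open>\<open>cube n\<close> is the face \<open>x n = 0\<close> of the next cube;
  \<open>a(n := c)\<close> plays the role of the pair (a, c) and \<open>x(n := 0)\<close> that of
  the projection.\<close>

lemma cube_Suc_iff:
  "x \<in> topspace (cube (Suc n)) \<longleftrightarrow> x(n := 0) \<in> topspace (cube n) \<and> 0 \<le> x n \<and> x n \<le> 1"
proof -
  have "(\<forall>i<Suc n. 0 \<le> x i \<and> x i \<le> 1) \<longleftrightarrow> (\<forall>i<n. 0 \<le> x i \<and> x i \<le> 1) \<and> 0 \<le> x n \<and> x n \<le> 1"
    using less_Suc_eq by auto
  moreover have "(\<forall>i\<ge>Suc n. x i = 0) \<longleftrightarrow> (\<forall>i\<ge>n. (x(n := 0)) i = 0)"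
    using Suc_le_eq le_neq_implies_less by auto
  ultimately show ?thesis
    by (auto simp: topspace_cube)
qed

lemma cube_upd_zero: "a \<in> topspace (cube n) \<Longrightarrow> a(n := 0) = a"
  by (auto simp: topspace_cube)

lemma upd_in_cube_Suc:
  "a \<in> topspace (cube n) \<Longrightarrow> 0 \<le> c \<Longrightarrow> c \<le> 1 \<Longrightarrow> a(n := c) \<in> topspace (cube (Suc n))"
  using cube_upd_zero[of a n] unfolding cube_Suc_iff by simp

lemma continuous_on_upd:
  fixes f :: "'a::topological_space \<Rightarrow> nat \<Rightarrow> real"
  assumes "continuous_on S f" "continuous_on S g"
  shows "continuous_on S (\<lambda>x. (f x)(n := g x))"
proof (rule continuous_on_coordinatewise_then_product)
  fix i
  show "continuous_on S (\<lambda>x. ((f x)(n := g x)) i)"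
    using assms continuous_on_product_then_coordinatewise[OF assms(1), of i] by (cases "i = n") auto
qed

lemma continuous_on_coordinate: "continuous_on S (\<lambda>x::nat \<Rightarrow> real. x i)"
  by (rule continuous_on_product_then_coordinatewise[OF continuous_on_id])

lemma cube_closure_of: "S \<subseteq> topspace (cube n) \<Longrightarrow> cube n closure_of S = closure S"
proof -
  assume S: "S \<subseteq> topspace (cube n)"
  then have "closure S \<subseteq> topspace (cube n)"
    by (simp add: closure_minimal compact_imp_closed compact_topspace_cube)
  then show ?thesis
    using S by (subst cube_eq_top_of_set) (simp add: closure_of_subtopology Int_absorb1)
qed

text \<open>Applied to the heights at which a vertical segment meets an open subset of the
  slab.\<close>

lemma openin_Icc_countable_imp_empty:
  fixes a b :: real
  assumes "openin (top_of_set {a..b}) V" "countable V" "a < b"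
  shows "V = {}"
proof (rule ccontr)
  assume "V \<noteq> {}"
  obtain T where T: "open T" "V = {a..b} \<inter> T"
    using assms(1) by (auto simp: openin_open)
  \<comment> \<open>The given point of \<open>V\<close> may be an endpoint; density of the open
    interval moves it inside.\<close>
  have "T \<inter> closure {a<..<b} \<noteq> {}"
    using \<open>V \<noteq> {}\<close> T(2) \<open>a < b\<close> by (simp add: Int_commute)
  then have "T \<inter> {a<..<b} \<noteq> {}"
    using open_Int_closure_eq_empty[OF T(1)] by blast
  then obtain d where d: "d \<in> T \<inter> {a<..<b}"
    by blast
  have "open (T \<inter> {a<..<b})"
    using T(1) by (intro open_Int) auto
  then obtain e where e: "e > 0" "ball d e \<subseteq> T \<inter> {a<..<b}"
    using d by (rule openE)
  have "{d<..<d + e} \<subseteq> ball d e"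
    by (auto simp: dist_real_def)
  then have "{d<..<d + e} \<subseteq> V"
    using e(2) T(2) by force
  then have "countable {d<..<d + e}"
    using assms(2) countable_subset by blast
  then show False
    using e(1) uncountable_open_interval[of d "d + e"] by simp
qed

lemma upd_image_Times: "(\<lambda>(a, c). a(n := c)) ` (A \<times> D) = (\<Union>c\<in>D. (\<lambda>a. a(n := c)) ` A)"
proof (intro subset_antisym subsetI)
  fix x assume "x \<in> (\<lambda>(a, c). a(n := c)) ` (A \<times> D)"
  then show "x \<in> (\<Union>c\<in>D. (\<lambda>a. a(n := c)) ` A)"
    by auto
next
  fix x assume "x \<in> (\<Union>c\<in>D. (\<lambda>a. a(n := c)) ` A)"
  then obtain a c where "x = a(n := c)" "a \<in> A" "c \<in> D"
    by auto
  then show "x \<in> (\<lambda>(a, c). a(n := c)) ` (A \<times> D)"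
    by (intro image_eqI[of _ _ "(a, c)"]) simp_all
qed

definition lower_half :: "nat \<Rightarrow> (nat \<Rightarrow> real) set" where
  "lower_half n = {x \<in> topspace (cube (Suc n)). x n \<le> 1/2}"

definition slab :: "nat \<Rightarrow> (nat \<Rightarrow> real) set \<Rightarrow> (nat \<Rightarrow> real) set" where
  "slab n A = lower_half n \<union> (\<Union>k. (\<lambda>a. a(n := slope k)) ` A)"

lemma closed_lower_half: "closed (lower_half n)"
proof -
  have "lower_half n = topspace (cube (Suc n)) \<inter> {x. x n \<le> 1/2}"
    by (auto simp: lower_half_def)
  also have "closed \<dots>"
    by (intro closed_Int compact_imp_closed compact_topspace_cube closed_Collect_le
        continuous_on_coordinate continuous_on_const)
  finally show ?thesis .
qed

text \<open>The copies of \<open>A\<close> accumulate only at height 1/2, where the limit copy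
  already belongs to the lower half; adding it makes the set of heights compact.\<close>

lemma slab_in_effros:
  assumes "A \<in> space (effros (cube n))"
  shows "slab n A \<in> space (effros (cube (Suc n)))"
proof -
  have A: "compact A" "A \<subseteq> topspace (cube n)"
    using assms by (auto simp: space_effros_cube)
  have half: "a(n := 1/2) \<in> lower_half n" if "a \<in> topspace (cube n)" for a
    using upd_in_cube_Suc[OF that, of "1/2"] by (simp add: lower_half_def)
  let ?D = "insert (1/2) (range slope)"
  have D: "?D = fan_slopes True \<union> fan_slopes False"
    by (auto simp: fan_slopes_def)
  have img: "(\<lambda>(a, c). a(n := c)) ` (A \<times> ?D) = (\<lambda>a. a(n := 1/2)) ` A \<union> (\<Union>k. (\<lambda>a. a(n := slope k)) ` A)"
    by (simp add: upd_image_Times)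
  have slab: "slab n A = lower_half n \<union> (\<lambda>(a, c). a(n := c)) ` (A \<times> ?D)"
  proof -
    have "(\<lambda>a. a(n := 1/2)) ` A \<subseteq> lower_half n"
      using half A(2) by (intro image_subsetI) auto
    then have "lower_half n = lower_half n \<union> (\<lambda>a. a(n := 1/2)) ` A"
      by (simp add: Un_absorb2)
    then show ?thesis
      unfolding img slab_def by (metis Un_assoc)
  qed
  have "compact ((\<lambda>(a, c). a(n := c)) ` (A \<times> ?D))"
    unfolding D case_prod_beta
    by (intro compact_continuous_image continuous_on_upd continuous_on_fst continuous_on_snd
        continuous_on_id compact_Times A(1) compact_Un compact_fan_slopes)
  moreover have "lower_half n \<inter> topspace (cube (Suc n)) = lower_half n"
    by (auto simp: lower_half_def)
  then have "compact (lower_half n)"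
    using closed_Int_compact[OF closed_lower_half compact_topspace_cube, of n "Suc n"] by simp
  ultimately have "compact (slab n A)"
    unfolding slab by (intro compact_Un)
  moreover have "a(n := slope k) \<in> topspace (cube (Suc n))" if "a \<in> A" for a k
    using that A(2) slope_bounds[of k] by (intro upd_in_cube_Suc) auto
  then have "slab n A \<subseteq> topspace (cube (Suc n))"
    by (auto simp: slab_def lower_half_def)
  moreover have "(\<lambda>i. 0) \<in> lower_half n"
    by (simp add: lower_half_def topspace_cube)
  ultimately show ?thesis
    unfolding space_effros_cube slab_def by blast
qed

text \<open>From height 1/2 upwards a vertical segment meets the slab in countably many points, so
  no interior point lies there.\<close>

lemma interior_of_slab:
  assumes "A \<subseteq> topspace (cube n)"
  shows "cube (Suc n) interior_of slab n A = {x \<in> topspace (cube (Suc n)). x n < 1/2}"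
proof
  let ?Q = "topspace (cube (Suc n))"
  have "openin (cube (Suc n)) (?Q \<inter> {x. x n < 1/2})"
    by (subst cube_eq_top_of_set)
      (intro openin_open_Int open_Collect_less continuous_on_coordinate continuous_on_const)
  moreover have "?Q \<inter> {x. x n < 1/2} \<subseteq> slab n A"
    by (auto simp: slab_def lower_half_def)
  ultimately have "?Q \<inter> {x. x n < 1/2} \<subseteq> cube (Suc n) interior_of slab n A"
    by (rule interior_of_maximal[rotated])
  then show "{x \<in> ?Q. x n < 1/2} \<subseteq> cube (Suc n) interior_of slab n A"
    by blast
  show "cube (Suc n) interior_of slab n A \<subseteq> {x \<in> ?Q. x n < 1/2}"
  proof
    fix x assume x: "x \<in> cube (Suc n) interior_of slab n A"
    let ?U = "cube (Suc n) interior_of slab n A"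
    have xQ: "x \<in> ?Q"
      using x interior_of_subset_topspace[of "cube (Suc n)" "slab n A"] by blast
    then have x0: "x(n := 0) \<in> topspace (cube n)" "x n \<le> 1"
      by (simp_all add: cube_Suc_iff)
    define V where "V = {1/2..1} \<inter> (\<lambda>c. x(n := c)) -` ?U"
    have "openin (top_of_set ?Q) ?U"
      unfolding cube_eq_top_of_set[symmetric] by simp
    moreover have "x(n := c) \<in> ?Q" if "c \<in> {1/2..1}" for c
      using upd_in_cube_Suc[OF x0(1), of c] that by simp
    ultimately have "openin (top_of_set {1/2..1}) V"
      unfolding V_def
      by (intro continuous_openin_preimage[where T="?Q"] continuous_on_upd continuous_on_const
          continuous_on_id) auto
    moreover have "V \<subseteq> insert (1/2) (range slope)"
    proof
      fix c assume "c \<in> V"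
      then have "c \<in> {1/2..1}" "x(n := c) \<in> slab n A"
        using interior_of_subset[of "cube (Suc n)" "slab n A"] unfolding V_def by blast+
      then have "c = 1/2 \<or> (\<exists>k a. x(n := c) = a(n := slope k))"
        by (auto simp: slab_def lower_half_def)
      then show "c \<in> insert (1/2) (range slope)"
        by (metis fun_upd_same insertCI rangeI)
    qed
    then have "countable V"
      by (rule countable_subset) simp
    ultimately have "V = {}"
      by (rule openin_Icc_countable_imp_empty) simp
    then have "x n \<notin> {1/2..1}"
      using x by (auto simp: V_def)
    then show "x \<in> {x \<in> ?Q. x n < 1/2}"
      using x0(2) xQ by auto
  qed
qed

lemma closure_interior_of_slab:
  assumes "A \<subseteq> topspace (cube n)"
  shows "closure (cube (Suc n) interior_of slab n A) = lower_half n"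
proof
  let ?H = "{x \<in> topspace (cube (Suc n)). x n < 1/2}"
  show "closure (cube (Suc n) interior_of slab n A) \<subseteq> lower_half n"
    unfolding interior_of_slab[OF assms]
    by (rule closure_minimal[OF _ closed_lower_half]) (auto simp: lower_half_def)
  show "lower_half n \<subseteq> closure (cube (Suc n) interior_of slab n A)"
    unfolding interior_of_slab[OF assms]
  proof
    fix x assume "x \<in> lower_half n"
    then have x: "x(n := 0) \<in> topspace (cube n)" "0 \<le> x n" "x n \<le> 1/2"
      by (simp_all add: lower_half_def cube_Suc_iff)
    have "x(n := c) \<in> ?H" if "c \<in> {0..<1/2}" for c
      using upd_in_cube_Suc[OF x(1), of c] that by simp
    then have "(\<lambda>c. x(n := c)) ` {0..<1/2} \<subseteq> closure ?H"
      using closure_subset by blast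
    then have "(\<lambda>c. x(n := c)) ` closure {0..<1/2} \<subseteq> closure ?H"
      by (intro image_closure_subset continuous_on_upd continuous_on_const continuous_on_id
          closed_closure)
    moreover have "x n \<in> closure {0..<1/2}"
      using x by simp
    ultimately have "x(n := x n) \<in> closure ?H"
      by blast
    then show "x \<in> closure ?H"
      by simp
  qed
qed

text \<open>The projection maps the leaves into the closed set \<open>A\<close>, hence also their
  closure; conversely the heights \<open>slope k\<close> tend to 1/2.\<close>

lemma closure_slab_leaves:
  assumes "A \<subseteq> topspace (cube n)" "closed A"
  shows "closure (slab n A - lower_half n) \<inter> {x. x n = 1/2} = (\<lambda>a. a(n := 1/2)) ` A"
proof -
  have "slab n A - lower_half n = (\<Union>k. (\<lambda>a. a(n := slope k)) ` A)"
    using slope_bounds(1) by (auto simp: slab_def lower_half_def) (meson linorder_not_le)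
  then have eq: "slab n A - lower_half n = (\<lambda>(a, c). a(n := c)) ` (A \<times> range slope)"
    by (simp add: upd_image_Times)
  have cont: "continuous_on S (\<lambda>(a, c). a(n := c))" for S :: "((nat \<Rightarrow> real) \<times> real) set"
    unfolding case_prod_beta
    by (intro continuous_on_upd continuous_on_fst continuous_on_snd continuous_on_id)
  show ?thesis
  proof
    have "x(n := 0) \<in> A" if "x \<in> closure (slab n A - lower_half n)" for x
    proof -
      have "(\<lambda>x. x(n := 0)) ` (slab n A - lower_half n) \<subseteq> A"
        unfolding eq using assms(1) cube_upd_zero by fastforce
      then have "(\<lambda>x. x(n := 0)) ` closure (slab n A - lower_half n) \<subseteq> A"
        by (intro image_closure_subset assms(2) continuous_on_upd continuous_on_id continuous_on_const)
      then show ?thesis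
        using that by blast
    qed
    then show "closure (slab n A - lower_half n) \<inter> {x. x n = 1/2} \<subseteq> (\<lambda>a. a(n := 1/2)) ` A"
      by (auto intro!: image_eqI[of _ _ "_(n := 0)"])
    have "slope \<longlonglongrightarrow> 1/2"
      by (rule slope_tendsto)
    then have half: "1/2 \<in> closure (range slope)"
      unfolding closure_sequential by (intro exI[of _ slope]) simp
    have "(\<lambda>(a, c). a(n := c)) ` closure (A \<times> range slope) \<subseteq> closure (slab n A - lower_half n)"
      unfolding eq by (intro image_closure_subset cont closed_closure closure_subset)
    moreover have "(a, 1/2) \<in> closure (A \<times> range slope)" if "a \<in> A" for a
      using that half closure_subset[of A] by (auto simp: closure_Times)
    ultimately show "(\<lambda>a. a(n := 1/2)) ` A \<subseteq> closure (slab n A - lower_half n) \<inter> {x. x n = 1/2}"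
      by force
  qed
qed

lemma homeomorphic_map_image_interior_closure:
  assumes f: "homeomorphic_map (cube m) (cube m) f" and S: "S \<subseteq> topspace (cube m)"
  shows "f ` (cube m interior_of S) = cube m interior_of (f ` S)"
    and "f ` closure S = closure (f ` S)"
proof -
  show "f ` (cube m interior_of S) = cube m interior_of (f ` S)"
    using homeomorphic_map_interior_of[OF f S] by simp
  have "f ` S \<subseteq> topspace (cube m)"
    using S homeomorphic_imp_surjective_map[OF f] by blast
  then show "f ` closure S = closure (f ` S)"
    using homeomorphic_map_closure_of[OF f S] S by (simp add: cube_closure_of)
qed

lemma homeomorphism_restricts_to_middle:
  assumes A: "A \<in> space (effros (cube n))" and B: "B \<in> space (effros (cube n))"
    and fg: "homeomorphism (topspace (cube (Suc n))) (topspace (cube (Suc n))) f g"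
    and slab: "f ` slab n A = slab n B"
  shows "f ` {x \<in> topspace (cube (Suc n)). x n = 1/2} = {x \<in> topspace (cube (Suc n)). x n = 1/2}"
    and "f ` (\<lambda>a. a(n := 1/2)) ` A = (\<lambda>a. a(n := 1/2)) ` B"
proof -
  let ?Q = "topspace (cube (Suc n))"
  have hom: "homeomorphic_map (cube (Suc n)) (cube (Suc n)) f"
    using fg by (metis cube_eq_top_of_set homeomorphic_map_maps homeomorphic_maps_top_of_set)
  have inj: "inj_on f ?Q"
    using fg inj_on_inverseI[of ?Q g f] by (simp add: homeomorphism_def)
  have AQ: "A \<subseteq> topspace (cube n)" and "closed A" and BQ: "B \<subseteq> topspace (cube n)" and "closed B"
    using A B by (auto simp: space_effros_cube compact_imp_closed)
  have sA: "slab n A \<subseteq> ?Q"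
    using slab_in_effros[OF A] by (simp add: space_effros_cube)
  have intr: "f ` (cube (Suc n) interior_of slab n A) = cube (Suc n) interior_of slab n B"
    unfolding homeomorphic_map_image_interior_closure(1)[OF hom sA] slab ..
  then have lower: "f ` lower_half n = lower_half n"
    using homeomorphic_map_image_interior_closure(2)[OF hom interior_of_subset_topspace,
        of "slab n A"]
    unfolding intr closure_interior_of_slab[OF AQ] closure_interior_of_slab[OF BQ] by simp
  \<comment> \<open>The face is what the closure adds to the interior. It is the same for every
    \<open>C\<close>, so it can be expressed through \<open>A\<close> before and through
    \<open>B\<close> after applying \<open>f\<close>.\<close>
  have middle: "{x \<in> ?Q. x n = 1/2} = lower_half n - cube (Suc n) interior_of slab n C"
    if "C \<subseteq> topspace (cube n)" for C
    unfolding interior_of_slab[OF that] by (auto simp: lower_half_def)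
  have lowQ: "lower_half n \<subseteq> ?Q"
    by (auto simp: lower_half_def)
  have "f ` (lower_half n - cube (Suc n) interior_of slab n A) =
      f ` lower_half n - f ` (cube (Suc n) interior_of slab n A)"
    by (rule inj_on_image_set_diff[OF inj])
      (use lowQ interior_of_subset_topspace[of "cube (Suc n)" "slab n A"] in blast)+
  then show mid: "f ` {x \<in> ?Q. x n = 1/2} = {x \<in> ?Q. x n = 1/2}"
    unfolding lower intr middle[OF AQ, symmetric] middle[OF BQ, symmetric] .
  have diff: "f ` (slab n A - lower_half n) = slab n B - lower_half n"
    using inj_on_image_set_diff[OF inj, of "slab n A" "lower_half n"] sA lowQ
    unfolding slab lower by blast
  have clQ: "closure (slab n A - lower_half n) \<subseteq> ?Q"
    by (rule closure_minimal) (use sA in \<open>auto intro: compact_imp_closed compact_topspace_cube\<close>)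
  have leaves: "(\<lambda>a. a(n := 1/2)) ` C = closure (slab n C - lower_half n) \<inter> {x \<in> ?Q. x n = 1/2}"
    if C: "C \<in> space (effros (cube n))" for C
  proof -
    have CQ: "C \<subseteq> topspace (cube n)" "closed C"
      using C by (auto simp: space_effros_cube compact_imp_closed)
    have "(\<lambda>a. a(n := 1/2)) ` C \<subseteq> ?Q"
      using CQ(1) by (intro image_subsetI upd_in_cube_Suc) auto
    then show ?thesis
      using closure_slab_leaves[OF CQ] by blast
  qed
  have "f ` (closure (slab n A - lower_half n) \<inter> {x \<in> ?Q. x n = 1/2}) =
      f ` closure (slab n A - lower_half n) \<inter> f ` {x \<in> ?Q. x n = 1/2}"
    by (rule inj_on_image_Int[OF inj clQ]) blast
  also have "f ` closure (slab n A - lower_half n) = closure (slab n B - lower_half n)"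
    using homeomorphic_map_image_interior_closure(2)[OF hom, of "slab n A - lower_half n"] sA
    unfolding diff by blast
  finally show "f ` (\<lambda>a. a(n := 1/2)) ` A = (\<lambda>a. a(n := 1/2)) ` B"
    unfolding mid leaves[OF A] leaves[OF B] .
qed

theorem R_rel_reducible_Suc:
  "borel_reducible (effros (cube n)) (R_rel n) (effros (cube (Suc n))) (R_rel (Suc n))"
  unfolding borel_reducible_def
proof (intro bexI ballI)
  let ?Q = "topspace (cube n)" and ?Q' = "topspace (cube (Suc n))"
  have "(\<lambda>a. a(n := slope k)) ` ?Q \<subseteq> ?Q'" for k
    using slope_bounds[of k] by (intro image_subsetI upd_in_cube_Suc) auto
  then have "(\<lambda>A. lower_half n \<union> (\<Union>k. (\<lambda>a. a(n := slope k)) ` A)) \<in>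
      measurable (effros (top_of_set ?Q)) (effros (top_of_set ?Q'))"
    using slab_in_effros unfolding slab_def
    by (intro measurable_effros_union_images continuous_on_upd continuous_on_id continuous_on_const)
      (simp_all add: cube_eq_top_of_set[symmetric])
  then show "slab n \<in> measurable (effros (cube n)) (effros (cube (Suc n)))"
    unfolding slab_def[abs_def] cube_eq_top_of_set[symmetric] .
  fix A B assume A: "A \<in> space (effros (cube n))" and B: "B \<in> space (effros (cube n))"
  have AQ: "A \<subseteq> ?Q" and BQ: "B \<subseteq> ?Q"
    using A B by (auto simp: space_effros_cube)
  have "(\<exists>f g. homeomorphism ?Q ?Q f g \<and> f ` A = B) \<longleftrightarrow>
      (\<exists>f g. homeomorphism ?Q' ?Q' f g \<and> f ` slab n A = slab n B)"
  proof
    assume "\<exists>f g. homeomorphism ?Q ?Q f g \<and> f ` A = B"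
    then obtain f g where fg: "homeomorphism ?Q ?Q f g" and fA: "f ` A = B"
      by blast
    \<comment> \<open>\<open>E h\<close> is h x id: it acts on the first \<open>n\<close>
      coordinates and keeps the height, so it respects the lower half and moves each leaf by
      \<open>h\<close>.\<close>
    define E where "E h x = (h (x(n := 0)))(n := x n)" for h and x :: "nat \<Rightarrow> real"
    have E: "continuous_on ?Q' (E h)" "E h ` ?Q' \<subseteq> ?Q'"
      if h: "continuous_on ?Q h" "h ` ?Q \<subseteq> ?Q" for h
    proof -
      have "continuous_on ?Q' (\<lambda>x. x(n := 0))"
        by (intro continuous_on_upd continuous_on_id continuous_on_const)
      then show "continuous_on ?Q' (E h)"
        unfolding E_def
        by (intro continuous_on_upd continuous_on_coordinate continuous_on_compose2[OF h(1)])
          (auto simp: cube_Suc_iff)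
      show "E h ` ?Q' \<subseteq> ?Q'"
      proof (rule image_subsetI)
        fix x assume "x \<in> ?Q'"
        then have "x(n := 0) \<in> ?Q" "0 \<le> x n" "x n \<le> 1"
          by (simp_all add: cube_Suc_iff)
        then show "E h x \<in> ?Q'"
          unfolding E_def using h(2) by (intro upd_in_cube_Suc) auto
      qed
    qed
    have inv: "E k (E h x) = x" if "h ` ?Q \<subseteq> ?Q" "\<And>a. a \<in> ?Q \<Longrightarrow> k (h a) = a" "x \<in> ?Q'" for h k x
    proof -
      have x: "x(n := 0) \<in> ?Q"
        using that(3) by (simp add: cube_Suc_iff)
      then have "(h (x(n := 0)))(n := 0) = h (x(n := 0))"
        using that(1) by (intro cube_upd_zero) auto
      then show ?thesis
        using that(2)[OF x] by (simp add: E_def)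
    qed
    have f: "continuous_on ?Q f" "f ` ?Q \<subseteq> ?Q" "\<And>a. a \<in> ?Q \<Longrightarrow> g (f a) = a"
      and g: "continuous_on ?Q g" "g ` ?Q \<subseteq> ?Q" "\<And>a. a \<in> ?Q \<Longrightarrow> f (g a) = a"
      using fg by (simp_all add: homeomorphism_def)
    have hom: "homeomorphism ?Q' ?Q' (E f) (E g)"
      by (intro homeomorphismI E f(1,2) g(1,2) inv[OF f(2,3)] inv[OF g(2,3)])
    have low: "E h ` lower_half n \<subseteq> lower_half n" if "continuous_on ?Q h" "h ` ?Q \<subseteq> ?Q" for h
      using E(2)[OF that] by (auto simp: lower_half_def E_def)
    have "E f ` lower_half n = lower_half n"
    proof
      show "lower_half n \<subseteq> E f ` lower_half n"
      proof
        fix x assume x: "x \<in> lower_half n"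
        then have "E f (E g x) = x"
          by (intro inv g) (auto simp: lower_half_def)
        then show "x \<in> E f ` lower_half n"
          using low[OF g(1,2)] x by (metis image_eqI image_subset_iff)
      qed
    qed (rule low[OF f(1,2)])
    moreover have "E f ` (\<lambda>a. a(n := c)) ` A = (\<lambda>a. a(n := c)) ` B" for c
    proof -
      have "E f (a(n := c)) = (f a)(n := c)" if "a \<in> A" for a
        using cube_upd_zero[of a n] that AQ by (auto simp: E_def)
      then show ?thesis
        unfolding fA[symmetric] image_image by (rule image_cong[OF refl])
    qed
    ultimately have "E f ` slab n A = slab n B"
      by (simp add: slab_def image_Un image_UN)
    then show "\<exists>f g. homeomorphism ?Q' ?Q' f g \<and> f ` slab n A = slab n B"
      using hom by blast
  next
    assume "\<exists>f g. homeomorphism ?Q' ?Q' f g \<and> f ` slab n A = slab n B"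
    then obtain f g where fg: "homeomorphism ?Q' ?Q' f g" and slab: "f ` slab n A = slab n B"
      by blast
    let ?M = "{x \<in> ?Q'. x n = 1/2}"
    note middle = homeomorphism_restricts_to_middle[OF A B fg slab]
    have M: "homeomorphism ?M ?M f g"
      by (rule homeomorphism_of_subsets[OF fg _ _ middle(1)]) blast+
    \<comment> \<open>Conjugation with this identification turns the restriction of \<open>f\<close>
      to the middle face into a homeomorphism of the n-cube.\<close>
    have i: "homeomorphism ?Q ?M (\<lambda>a. a(n := 1/2)) (\<lambda>x. x(n := 0))"
    proof (rule homeomorphismI)
      show "(\<lambda>a. a(n := 1/2)) ` ?Q \<subseteq> ?M"
        using upd_in_cube_Suc[of _ n "1/2"] by auto
      show "(\<lambda>x. x(n := 0)) ` ?M \<subseteq> ?Q"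
        by (auto simp: cube_Suc_iff)
      show "(x(n := 0))(n := 1/2) = x" if "x \<in> ?M" for x
        using that by auto
    qed (auto simp: cube_upd_zero intro!: continuous_on_upd continuous_on_id continuous_on_const)
    let ?h = "(\<lambda>x. x(n := 0)) \<circ> (f \<circ> (\<lambda>a. a(n := 1/2)))"
    have "homeomorphism ?Q ?M (f \<circ> (\<lambda>a. a(n := 1/2))) ((\<lambda>x. x(n := 0)) \<circ> g)"
      by (rule homeomorphism_compose[OF i M])
    then have "homeomorphism ?Q ?Q ?h (((\<lambda>x. x(n := 0)) \<circ> g) \<circ> (\<lambda>a. a(n := 1/2)))"
      by (rule homeomorphism_compose[OF _ homeomorphism_symD[OF i]])
    moreover have "?h ` A = (\<lambda>x. x(n := 0)) ` f ` (\<lambda>a. a(n := 1/2)) ` A"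
      by (simp add: image_image)
    moreover have "(\<lambda>x. x(n := 0)) ` (\<lambda>a. a(n := 1/2)) ` B = B"
      using BQ cube_upd_zero by (force simp: image_image)
    ultimately show "\<exists>f g. homeomorphism ?Q ?Q f g \<and> f ` A = B"
      unfolding middle(2) by blast
  qed
  then show "(A, B) \<in> R_rel n \<longleftrightarrow> (slab n A, slab n B) \<in> R_rel (Suc n)"
    using A B slab_in_effros[OF A] slab_in_effros[OF B] unfolding R_rel_iff_homeomorphism by blast
qed

theorem theorem1:
  fixes n :: nat
  assumes "n \<ge> 1"
  shows "borel_reducible (effros (cube n)) (H_rel n) (continua (cube (n + 2))) (C_rel (n + 2)) \<and>
         borel_reducible (effros (cube n)) (R_rel n) (continua (cube (n + 2))) (C_rel (n + 2)) \<and>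
         borel_reducible (effros (cube n)) (R_rel n) (effros (cube (n + 1))) (R_rel (n + 1))"
  using H_rel_reducible_C_rel R_rel_reducible_C_rel R_rel_reducible_Suc[of n]
  unfolding Suc_eq_plus1 by blast

end
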